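(* Let $\mu$ be a classically infinitely divisible probability measure on $\mathbb{R}$ with characteristic function $\phi_\mu$ and Khintchine pair $[a,m]$, i.e. $$\log\phi_\mu(t)=ita+\int_{\mathbb{R}}\Big(e^{itx}-1-\frac{itx}{1+x^2}\Big)\frac{1+x^2}{x^2}\,m(dx),\qquad t\in\mathbb{R}.$$ Then there exists a unique $\boxplus$-infinitely divisible probability measure $\tilde\mu$ whose Voiculescu transform satisfies $$V_{\tilde\mu}(it)=it^2\int_0^\infty \overline{\log\phi_\mu(s)}\,e^{-ts}\,ds,\qquad t>0,\tag{A}$$ and moreover, for all $t>0$, $$it^2\int_0^\infty \overline{\log\phi_\mu(s)}\,e^{-ts}\,ds=a+\int_{\mathbb{R}}\frac{1+itx}{it-x}\,m(dx).\tag{Z}$$ If in addition $\mu$ is symmetric, i.e. $a=0$ and $m$ is symmetric (so $\phi_\mu$ is real), then for $t>0$ $$V_{\tilde\mu}(it)=it\int_0^\infty\int_{\mathbb{R}}(\cos(sx)-1)\frac{1+x^2}{x^2}\,m(dx)\,t e^{-st}\,ds=-it\int_{\mathbb{R}}\frac{1+x^2}{t^2+x^2}\,m(dx).$$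
   Context: A characteristic function $\phi$ on $\mathbb{R}$ is (classically) infinitely divisible iff it has the Khintchine representation $\phi(t)=\exp\{ita+\int_{\mathbb{R}}(e^{itx}-1-\frac{itx}{1+x^2})\frac{1+x^2}{x^2}m(dx)\}$ with a uniquely determined $a\in\mathbb{R}$ and finite Borel measure $m$ on $\mathbb{R}$ (the integrand at $x=0$ is understood as its limit $-t^2/2$); the pair $[a,m]$ is its Khintchine pair, and $\log\phi$ denotes the exponent in this representation (the continuous logarithm with $\log\phi(0)=0$). For a probability measure $\nu$ on $\mathbb{R}$, $V_\nu$ denotes its Voiculescu transform (so that $V_{\mu\boxplus\nu}=V_\mu+V_\nu$, $\boxplus$ being free additive convolution). Free Lévy–Khintchine characterization: $\nu$ is $\boxplus$-infinitely divisible iff $V_\nu(z)=a+\int_{\mathbb{R}}\frac{1+zx}{z-x}m(dx)$ for $z\in\mathbb{C}\setminus\mathbb{R}$, with uniquely determined $a\in\mathbb{R}$ and finite Borel measure $m$; moreover a $\boxplus$-infinitely divisible $\nu$ is uniquely determined by the values $V_\nu(it)$, $t>0$. *)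

theory Defs
  imports "HOL-Analysis.Analysis" "HOL-Probability.Probability"
begin

text \<open>Integrand of the Khintchine representation; at x = 0 it is its limit -t^2/2.\<close>
definition khintchine_integrand :: "real \<Rightarrow> real \<Rightarrow> complex" where
  "khintchine_integrand t x =
     (if x = 0 then - complex_of_real (t^2 / 2)
      else (exp (\<i> * complex_of_real (t * x)) - 1 - \<i> * complex_of_real (t * x / (1 + x^2)))
           * complex_of_real ((1 + x^2) / x^2))"

definition khintchine_exponent :: "real \<Rightarrow> real measure \<Rightarrow> real \<Rightarrow> complex" where
  "khintchine_exponent a m t =
     \<i> * complex_of_real (t * a) + (CLINT x|m. khintchine_integrand t x)"

definition khintchine_pair :: "real measure \<Rightarrow> real \<Rightarrow> real measure \<Rightarrow> bool" where
  "khintchine_pair \<mu> a m \<longleftrightarrow>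
     prob_space \<mu> \<and> sets \<mu> = sets borel \<and>
     finite_measure m \<and> sets m = sets borel \<and>
     (\<forall>t. char \<mu> t = exp (khintchine_exponent a m t))"

definition cauchy_transform :: "real measure \<Rightarrow> complex \<Rightarrow> complex" where
  "cauchy_transform \<nu> z = (CLINT x|\<nu>. 1 / (z - complex_of_real x))"

definition F_transform :: "real measure \<Rightarrow> complex \<Rightarrow> complex" where
  "F_transform \<nu> z = 1 / cauchy_transform \<nu> z"

definition trunc_cone :: "real \<Rightarrow> real \<Rightarrow> complex set" where
  "trunc_cone \<alpha> \<beta> = {z. Im z > \<beta> \<and> \<bar>Re z\<bar> < \<alpha> * Im z}"

text \<open>phi is the Voiculescu transform of nu on S:
  phi(z) = F^{-1}(z) - z, where F^{-1} is the inverse of F_nu restricted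
  to a truncated cone on which F_nu is univalent (Bercovici--Voiculescu).\<close>
definition voiculescu_on :: "real measure \<Rightarrow> (complex \<Rightarrow> complex) \<Rightarrow> complex set \<Rightarrow> bool" where
  "voiculescu_on \<nu> \<phi> S \<longleftrightarrow>
     (\<exists>\<alpha>' \<beta>'. \<alpha>' > 0 \<and> \<beta>' > 0 \<and> inj_on (F_transform \<nu>) (trunc_cone \<alpha>' \<beta>') \<and>
        (\<forall>z\<in>S. z + \<phi> z \<in> trunc_cone \<alpha>' \<beta>' \<and> F_transform \<nu> (z + \<phi> z) = z))"

text \<open>Free infinite divisibility: for every n >= 1 there is a probability
  measure nu_n with nu = nu_n boxplus ... boxplus nu_n (n times), i.e.
  V_nu = n V_{nu_n} on a common truncated cone (definition of boxplus
  via the Voiculescu transform).\<close>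
definition free_inf_div :: "real measure \<Rightarrow> bool" where
  "free_inf_div \<nu> \<longleftrightarrow>
     prob_space \<nu> \<and> sets \<nu> = sets borel \<and>
     (\<forall>n::nat. n \<ge> 1 \<longrightarrow>
        (\<exists>\<nu>n \<phi> \<phi>n \<alpha> \<beta>. prob_space \<nu>n \<and> sets \<nu>n = sets borel \<and> \<alpha> > 0 \<and> \<beta> > 0 \<and>
           voiculescu_on \<nu> \<phi> (trunc_cone \<alpha> \<beta>) \<and>
           voiculescu_on \<nu>n \<phi>n (trunc_cone \<alpha> \<beta>) \<and>
           (\<forall>z\<in>trunc_cone \<alpha> \<beta>. \<phi> z = of_nat n * \<phi>n z)))"

text \<open>V_nu(it) = h(t) for all t > 0, where V_nu is the (analytic continuation to
  the upper half-plane of the) Voiculescu transform of nu.\<close>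
definition voiculescu_values_on_imag_axis :: "real measure \<Rightarrow> (real \<Rightarrow> complex) \<Rightarrow> bool" where
  "voiculescu_values_on_imag_axis \<nu> h \<longleftrightarrow>
     (\<exists>\<phi>. \<phi> holomorphic_on {z. Im z > 0} \<and>
        (\<exists>\<alpha> \<beta>. \<alpha> > 0 \<and> \<beta> > 0 \<and> voiculescu_on \<nu> \<phi> (trunc_cone \<alpha> \<beta>)) \<and>
        (\<forall>t>0. \<phi> (\<i> * complex_of_real t) = h t))"

definition symmetric_measure :: "real measure \<Rightarrow> bool" where
  "symmetric_measure m \<longleftrightarrow> distr m borel uminus = m"

text \<open>(cos(sx) - 1)(1+x^2)/x^2, with its limit -s^2/2 at x = 0.\<close>
definition cos_integrand :: "real \<Rightarrow> real \<Rightarrow> real" where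
  "cos_integrand s x = (if x = 0 then - (s^2 / 2) else (cos (s * x) - 1) * (1 + x^2) / x^2)"

end

theory Submission
  imports Defs "HOL-Complex_Analysis.Complex_Analysis" "HOL-Real_Asymp.Real_Asymp"
begin

text \<open>
  Put \<open>V z = a + \<integral> (1 + z x) / (z - x) dm\<close>, \<open>H z = z + V z\<close> and
  \<open>\<sigma> z = \<integral> (1 + x^2) / |z - x|^2 dm\<close>. Since \<open>Im (H z) = Im z (1 - \<sigma> z)\<close>, the set
  \<open>\<Omega>\<close> of points that \<open>H\<close> sends into the upper half-plane is \<open>{\<sigma> < 1}\<close>. On \<open>\<Omega>\<close> the map
  \<open>H\<close> is injective and proper, hence a conformal bijection onto the upper half-plane. Its inverse
  \<open>F\<close> is the reciprocal Cauchy transform of a probability measure \<open>\<nu>\<close> (Nevanlinna, obtained from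
  the Herglotz representation on the disc), so \<open>V\<close> is the Voiculescu transform of \<open>\<nu>\<close>. The pair
  \<open>(a/n, m/n)\<close> yields the \<open>n\<close>-th free convolution root. Uniqueness follows from the identity
  theorem and from the injectivity of the Cauchy transform, which is proved by comparing
  characteristic functions after smoothing with the Poisson kernel. Formula (Z) is the Laplace
  transform of the Khintchine integrand, integrated over \<open>m\<close> by Fubini.
\<close>

section \<open>Cauchy transforms of finite measures\<close>

text \<open>\<open>voiculescu_on\<close> refers to an actual inverse of the F-transform of a given
  measure, so a formula for \<open>V\<close> alone exhibits no measure: the inverse of
  \<open>H\<close> must exist on the whole upper half-plane before a Nevanlinna representation can
  apply to it. The obstacle is that \<open>V z\<close> need not be small against \<open>z\<close>
  uniformly there, because it can be large near the real axis. The substitute is a growth bound on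
  regions where \<open>\<sigma>\<close> is bounded. It serves three times. On
  \<open>\<Omega>\<close>, where \<open>\<sigma> < 1\<close>, it keeps preimages of bounded
  sequences bounded, and it gives the limit \<open>i y / F (i y) --> 1\<close>, which is what fixes
  the total mass of \<open>\<nu>\<close> at 1. On a truncated cone, where \<open>\<sigma>\<close> is
  at most a multiple of the mass of \<open>m\<close>, it makes \<open>H\<close> a small perturbation
  of the identity, so that \<open>H\<close> maps a cone into another cone.\<close>

lemma Im_le_cmod_diff_of_real: "Im z \<le> cmod (z - complex_of_real x)"
  using abs_Im_le_cmod[of "z - complex_of_real x"] by simp

lemma diff_of_real_nonzero: "Im z > 0 \<Longrightarrow> z - complex_of_real x \<noteq> 0"
  by (auto simp: complex_eq_iff)

lemma norm_inverse_diff_of_real_le: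
  assumes "Im z > 0"
  shows "cmod (1 / (z - complex_of_real x)) \<le> 1 / Im z"
  using assms Im_le_cmod_diff_of_real[of z x]
  by (simp add: norm_divide frac_le)

abbreviation upper_half_plane :: "complex set" where
  "upper_half_plane \<equiv> {z. Im z > 0}"

lemma open_upper_half_plane: "open upper_half_plane"
  by (rule open_halfspace_Im_gt)

lemma connected_upper_half_plane: "connected upper_half_plane"
  by (intro convex_connected convex_halfspace_Im_gt)

context finite_borel_measure
begin

lemmas sets_cong [measurable_cong] = M_is_borel

lemma integrable_cauchy_kernel:
  "Im z > 0 \<Longrightarrow> integrable M (\<lambda>x. 1 / (z - complex_of_real x))"
  by (rule integrable_const_bound[of _ "1 / Im z"])
     (auto intro!: AE_I2 norm_inverse_diff_of_real_le)

lemma norm_cauchy_transform_le: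
  assumes "Im z > 0"
  shows "cmod (cauchy_transform M z) \<le> measure M UNIV / Im z"
proof -
  have "cmod (cauchy_transform M z) \<le> (LINT x|M. 1 / Im z)"
    unfolding cauchy_transform_def
    by (rule Bochner_Integration.integral_norm_bound_integral)
       (use assms integrable_cauchy_kernel norm_inverse_diff_of_real_le in auto)
  also have "space M = UNIV"
    using sets_eq_imp_space_eq[OF M_is_borel] by simp
  then have "(LINT x|M. 1 / Im z) = measure M UNIV / Im z"
    by simp
  finally show ?thesis .
qed

text \<open>By partial fractions the error of the difference quotient of the kernel is exactly
  \<open>(w - z) / ((w - x) * (z - x)^2)\<close>. Near \<open>z\<close> it is
  \<open>O(w - z)\<close> uniformly in \<open>x\<close>, so integrating the bound against a finite
  measure suffices.\<close>

lemma cauchy_transform_has_field_derivative: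
  assumes z: "Im z > 0"
  shows "(cauchy_transform M has_field_derivative
           - (CLINT x|M. 1 / (z - complex_of_real x)^2)) (at z)"
proof -
  let ?k = "\<lambda>w x. 1 / (w - complex_of_real x)"
  define D where "D = (CLINT x|M. 1 / (z - complex_of_real x)^2)"
  define e where "e = Im z"
  have int2: "integrable M (\<lambda>x. 1 / (z - complex_of_real x)^2)"
  proof (rule integrable_const_bound[of _ "(1 / e)^2"])
    show "AE x in M. cmod (1 / (z - complex_of_real x)^2) \<le> (1 / e)^2"
    proof (rule AE_I2)
      fix x
      have "cmod (1 / (z - complex_of_real x)^2) = cmod (?k z x) ^ 2"
        by (simp add: norm_divide norm_power power_divide)
      also have "\<dots> \<le> (1 / e)^2"
        unfolding e_def by (intro power_mono norm_inverse_diff_of_real_le z) auto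
      finally show "cmod (1 / (z - complex_of_real x)^2) \<le> (1 / e)^2" .
    qed
  qed auto
  define C where "C = measure M (space M) * (2 / e) * (1 / e)^2"
  have bound: "cmod ((cauchy_transform M w - cauchy_transform M z) / (w - z) - (- D)) \<le> C * cmod (w - z)"
    if w: "w \<noteq> z" "dist w z < e / 2" for w
  proof -
    \<comment> \<open>Staying within \<open>e / 2\<close> of \<open>z\<close> keeps \<open>w\<close>
      at height \<open>e / 2\<close>; this is the origin of the factor \<open>2 / e\<close> in
      \<open>C\<close>.\<close>
    have Imw: "Im w > e / 2"
      using abs_Im_le_cmod[of "w - z"] w(2) by (auto simp: dist_norm e_def)
    then have Imw0: "Im w > 0" using z e_def by simp
    have "cauchy_transform M w - cauchy_transform M z = (CLINT x|M. ?k w x - ?k z x)"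
      unfolding cauchy_transform_def
      by (rule Bochner_Integration.integral_diff[symmetric]) (auto intro: integrable_cauchy_kernel Imw0 z)
    moreover have intq: "integrable M (\<lambda>x. (?k w x - ?k z x) / (w - z))"
      by (intro integrable_divide Bochner_Integration.integrable_diff integrable_cauchy_kernel Imw0 z)
    ultimately have "(cauchy_transform M w - cauchy_transform M z) / (w - z) - (- D)
        = (CLINT x|M. (?k w x - ?k z x) / (w - z) + 1 / (z - complex_of_real x)^2)"
      unfolding D_def by (subst Bochner_Integration.integral_add[OF intq int2]) simp
    also have "cmod \<dots> \<le> (LINT x|M. cmod (w - z) * (2 / e) * (1 / e)^2)"
    proof (rule Bochner_Integration.integral_norm_bound_integral)
      show "integrable M (\<lambda>x. (?k w x - ?k z x) / (w - z) + 1 / (z - complex_of_real x)^2)"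
        by (rule Bochner_Integration.integrable_add[OF intq int2])
      fix x
      have nz: "w - complex_of_real x \<noteq> 0" "z - complex_of_real x \<noteq> 0"
        using Imw0 z by (auto simp: diff_of_real_nonzero)
      have "(?k w x - ?k z x) / (w - z) + 1 / (z - complex_of_real x)^2
          = (w - z) * ?k w x * (?k z x)^2"
      proof -
        have "?k w x - ?k z x = - (w - z) * ?k w x * ?k z x"
          using nz by (simp add: field_simps)
        then have "(?k w x - ?k z x) / (w - z) = - ?k w x * ?k z x"
          using w(1) by (simp only: mult.assoc mult_minus_left) (simp only: minus_divide_left[symmetric] nonzero_mult_div_cancel_left eq_iff_diff_eq_0[symmetric] simp_thms)
        moreover have "1 / (z - complex_of_real x)^2 = ?k z x * ?k z x"
          by (simp add: power2_eq_square)
        moreover have "- ?k w x * ?k z x + ?k z x * ?k z x = (?k z x - ?k w x) * ?k z x"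
          by (simp add: algebra_simps)
        moreover have "?k z x - ?k w x = (w - z) * ?k w x * ?k z x"
          using nz by (simp add: field_simps)
        ultimately show ?thesis by (simp add: power2_eq_square)
      qed
      moreover have "cmod (?k w x) \<le> 2 / e"
        using norm_inverse_diff_of_real_le[OF Imw0, of x] frac_le[of 1 1 "e / 2" "Im w"] Imw z
        by (simp add: e_def)
      moreover have "cmod (?k z x) \<le> 1 / e"
        using norm_inverse_diff_of_real_le[OF z, of x] by (simp add: e_def)
      ultimately show "cmod ((?k w x - ?k z x) / (w - z) + 1 / (z - complex_of_real x)^2)
           \<le> cmod (w - z) * (2 / e) * (1 / e)^2"
        using z unfolding e_def
        by (simp only: norm_mult norm_power) (intro mult_mono power_mono; simp)
    qed auto
    also have "\<dots> = C * cmod (w - z)"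
      by (simp add: C_def)
    finally show ?thesis .
  qed
  have "((\<lambda>w. (cauchy_transform M w - cauchy_transform M z) / (w - z) - (- D)) \<longlongrightarrow> 0) (at z)"
  proof (rule Lim_null_comparison)
    show "\<forall>\<^sub>F w in at z. cmod ((cauchy_transform M w - cauchy_transform M z) / (w - z) - (- D)) \<le> C * cmod (w - z)"
      unfolding eventually_at using bound z by (intro exI[of _ "e/2"]) (auto simp: e_def)
    show "((\<lambda>w. C * cmod (w - z)) \<longlongrightarrow> 0) (at z)"
      by (rule tendsto_eq_intros refl | simp)+
  qed
  then show ?thesis
    unfolding has_field_derivative_iff D_def[symmetric] using LIM_zero_iff by blast
qed

lemma holomorphic_cauchy_transform:
  "cauchy_transform M holomorphic_on upper_half_plane"
  using cauchy_transform_has_field_derivative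
  by (auto simp: holomorphic_on_open open_upper_half_plane)

end

section \<open>The map \<open>z + V z\<close> and its inverse\<close>

text \<open>The integrand of the free Levy-Khintchine formula. For fixed \<open>x\<close> it maps
  the upper half-plane into the lower one, with value \<open>- \<i>\<close> at \<open>\<i>\<close>;
  for fixed \<open>z\<close> it is bounded in \<open>x\<close>, so every finite measure can be
  integrated against it.\<close>

definition nevanlinna_kernel :: "complex \<Rightarrow> real \<Rightarrow> complex" where
  "nevanlinna_kernel z x = (1 + z * complex_of_real x) / (z - complex_of_real x)"

text \<open>Here \<open>x\<close> enters only through the Cauchy kernel, so integrability and
  holomorphy of \<open>V\<close> are inherited from the Cauchy transform of
  \<open>m\<close>.\<close>

lemma nevanlinna_kernel_eq:
  assumes "Im z > 0"
  shows "nevanlinna_kernel z x = (1 + z^2) * (1 / (z - complex_of_real x)) - z"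
  using diff_of_real_nonzero[OF assms, of x]
  by (simp add: nevanlinna_kernel_def field_simps power2_eq_square)

text \<open>Here the weight \<open>1 + x^2\<close> and the summand \<open>x\<close> are real and
  free of \<open>z\<close>. The imaginary part can be read off, and the weight becomes the density
  that turns a Herglotz measure into \<open>\<nu>\<close>.\<close>

lemma nevanlinna_kernel_eq':
  assumes "Im z > 0"
  shows "nevanlinna_kernel z x = (1 + x^2) * (1 / (z - complex_of_real x)) + x"
  using diff_of_real_nonzero[OF assms, of x]
  by (simp add: nevanlinna_kernel_def field_simps power2_eq_square)

lemma nevanlinna_kernel_diff:
  assumes "Im w > 0" "Im z > 0"
  shows "nevanlinna_kernel w x - nevanlinna_kernel z x =
     - (w - z) * ((1 + complex_of_real x^2) / ((w - complex_of_real x) * (z - complex_of_real x)))"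
  using diff_of_real_nonzero[OF assms(1), of x] diff_of_real_nonzero[OF assms(2), of x]
  by (simp add: nevanlinna_kernel_def divide_simps) (simp add: algebra_simps power2_eq_square)

lemma Im_nevanlinna_kernel:
  assumes "Im z > 0"
  shows "Im (nevanlinna_kernel z x) = - Im z * ((1 + x^2) / (cmod (z - complex_of_real x))^2)"
proof -
  have "Im (1 / (z - complex_of_real x)) = - Im z / (cmod (z - complex_of_real x))^2"
    by (simp add: Im_divide cmod_power2)
  moreover have "nevanlinna_kernel z x = complex_of_real (1 + x^2) * (1 / (z - complex_of_real x)) + complex_of_real x"
    using nevanlinna_kernel_eq'[OF assms, of x] by simp
  ultimately show ?thesis by (simp only: Im_complex_of_real plus_complex.simps times_complex.simps Re_complex_of_real) (simp add: mult.commute)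
qed

text \<open>For \<open>\<bar>x\<bar> \<le> K\<close> the pole is at distance at least
  \<open>cmod w / 2\<close>, and the kernel is bounded by a constant. For larger \<open>x\<close>
  the point \<open>w\<close> may lie close to the pole. There AM-GM with weight
  \<open>\<eta>\<close> splits \<open>(1 + \<bar>x\<bar>) / cmod (w - x)\<close> into a constant, to
  be charged to the tail of the measure, and a square dominated by the integrand of
  \<open>\<sigma>\<close>.\<close>

lemma norm_nevanlinna_kernel_le:
  assumes w: "Im w > 0" "cmod w \<ge> 1" "cmod w \<ge> 2 * K" and K: "K \<ge> 0" and \<eta>: "\<eta> > 0"
  shows "cmod (nevanlinna_kernel w x) \<le> (2 + 2 * K) + cmod w *
    (1 / (2 * \<eta>) * indicator {x. \<bar>x\<bar> > K} x + \<eta> * ((1 + x^2) / (cmod (w - complex_of_real x))^2))"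
proof -
  define d where "d = cmod (w - complex_of_real x)"
  have d0: "d > 0" using diff_of_real_nonzero[OF w(1)] by (simp add: d_def)
  have nk: "cmod (nevanlinna_kernel w x) = cmod (1 + w * complex_of_real x) / d"
    by (simp add: nevanlinna_kernel_def d_def norm_divide)
  have num: "cmod (1 + w * complex_of_real x) \<le> 1 + cmod w * \<bar>x\<bar>"
    using norm_triangle_ineq[of 1 "w * complex_of_real x"] by (simp add: norm_mult)
  have s0: "(1 + x^2) / d^2 \<ge> 0" by (simp add: add_nonneg_nonneg)
  show ?thesis
  proof (cases "\<bar>x\<bar> > K")
    case False
    have "d \<ge> cmod w - \<bar>x\<bar>"
      unfolding d_def using norm_triangle_ineq2[of w "complex_of_real x"] by simp
    then have d: "d \<ge> cmod w / 2" using False w by simp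
    have "cmod (nevanlinna_kernel w x) \<le> (1 + cmod w * K) / (cmod w / 2)"
      unfolding nk using False w(2) d
      by (intro frac_le order_trans[OF num] add_left_mono mult_left_mono) (auto simp: K add_nonneg_nonneg)
    also have "\<dots> = 2 / cmod w + 2 * K" using w(1) by (auto simp: field_simps add_divide_distrib)
    also have "2 / cmod w \<le> 2" using w(2) frac_le[of 2 2 1 "cmod w"] by simp
    finally have "cmod (nevanlinna_kernel w x) \<le> 2 + 2 * K" by simp
    moreover have "0 \<le> cmod w * (\<eta> * ((1 + x^2) / d^2))"
      using s0 \<eta> by (intro mult_nonneg_nonneg) auto
    ultimately show ?thesis
      using False unfolding d_def[symmetric] by simp
  next
    case True
    define t where "t = (1 + \<bar>x\<bar>) / d"
    have "1 + cmod w * \<bar>x\<bar> \<le> cmod w * (1 + \<bar>x\<bar>)" using w(2) by (simp add: algebra_simps)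
    then have "cmod (nevanlinna_kernel w x) \<le> cmod w * t"
      unfolding nk t_def using num d0 by (simp add: divide_simps)
    moreover have "t \<le> 1 / (2 * \<eta>) + \<eta> * (t^2 / 2)"
    proof -
      have "(\<eta> * t - 1)^2 \<ge> 0" by simp
      then show ?thesis using \<eta> by (simp add: field_simps power2_eq_square)
    qed
    moreover have "\<eta> * (t^2 / 2) \<le> \<eta> * ((1 + x^2) / d^2)"
    proof (intro mult_left_mono)
      have "(1 + \<bar>x\<bar>)^2 \<le> 2 * (1 + x^2)"
        using zero_le_power2[of "1 - \<bar>x\<bar>"] by (simp add: power2_eq_square algebra_simps)
      then show "t^2 / 2 \<le> (1 + x^2) / d^2"
        using d0 by (simp add: t_def power_divide divide_simps)
    qed (use \<eta> in simp)
    ultimately have "cmod (nevanlinna_kernel w x) \<le> cmod w * (1 / (2 * \<eta>) + \<eta> * ((1 + x^2) / d^2))"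
      by (elim order_trans) (intro mult_left_mono, linarith, simp)
    then show ?thesis
      using True K unfolding d_def[symmetric] by simp
  qed
qed

context finite_borel_measure
begin

lemma integrable_nevanlinna_kernel: "Im z > 0 \<Longrightarrow> integrable M (nevanlinna_kernel z)"
  by (subst Bochner_Integration.integrable_cong[OF refl nevanlinna_kernel_eq])
     (assumption, intro Bochner_Integration.integrable_diff integrable_mult_right integrable_cauchy_kernel
        integrable_const)

lemma measure_tail_tendsto_0: "(\<lambda>n. measure M {x. \<bar>x\<bar> > real n}) \<longlonglongrightarrow> 0"
proof -
  have "(\<lambda>n. measure M {x. \<bar>x\<bar> > real n}) \<longlonglongrightarrow> measure M (\<Inter>n. {x. \<bar>x\<bar> > real n})"
    by (rule finite_Lim_measure_decseq) (auto simp: decseq_def M_is_borel)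
  moreover have "\<exists>n. \<not> real n < \<bar>x\<bar>" for x
    using reals_Archimedean2[of "\<bar>x\<bar>"] by (auto simp: not_less intro: less_imp_le)
  then have "(\<Inter>n. {x::real. \<bar>x\<bar> > real n}) = {}" by blast
  ultimately show ?thesis by simp
qed

end

text \<open>The pair is a locale because the whole construction is instantiated a second time, with
  the pair scaled by \<open>1 / n\<close>, to produce free convolution roots.\<close>

locale nevanlinna_data = finite_borel_measure m for m :: "real measure" +
  fixes a :: real
begin

definition V :: "complex \<Rightarrow> complex" where
  "V z = complex_of_real a + (CLINT x|m. nevanlinna_kernel z x)"

text \<open>Two roles meet here: \<open>\<sigma>\<close> is the quotient
  \<open>- Im (V z) / Im z\<close>, and its integrand is the modulus of the
  \<open>z\<close>-derivative of the kernel. Thus \<open>\<sigma> < 1\<close> controls the sign of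
  \<open>Im (H z)\<close> and the variation of \<open>V\<close> at once.\<close>

definition \<sigma> :: "complex \<Rightarrow> real" where
  "\<sigma> z = (LINT x|m. (1 + x^2) / (cmod (z - complex_of_real x))^2)"

definition H :: "complex \<Rightarrow> complex" where "H z = z + V z"

definition \<Omega> :: "complex set" where "\<Omega> = {z. Im z > 0 \<and> Im (H z) > 0}"

lemma V_eq:
  assumes "Im z > 0"
  shows "V z = complex_of_real a + (1 + z^2) * cauchy_transform m z - z * complex_of_real (measure m (space m))"
proof -
  have "(CLINT x|m. nevanlinna_kernel z x) =
    (CLINT x|m. (1 + z^2) * (1 / (z - complex_of_real x)) - z)"
    using assms by (intro Bochner_Integration.integral_cong nevanlinna_kernel_eq) auto
  also have "\<dots> = (1 + z^2) * cauchy_transform m z - z * complex_of_real (measure m (space m))"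
    unfolding cauchy_transform_def
    by (subst Bochner_Integration.integral_diff[OF integrable_mult_right[OF integrable_cauchy_kernel[OF assms]] integrable_const])
       (simp add: scaleR_conv_of_real mult.commute del: times_divide_eq_right times_divide_eq_left)
  finally show ?thesis by (simp add: V_def)
qed

lemma holomorphic_V: "V holomorphic_on upper_half_plane"
  by (rule holomorphic_transform[of "\<lambda>z. complex_of_real a + (1 + z^2) * cauchy_transform m z
        - z * complex_of_real (measure m (space m))"])
     (auto intro!: holomorphic_intros holomorphic_cauchy_transform simp: V_eq)

lemma holomorphic_H: "H holomorphic_on upper_half_plane"
  unfolding H_def[abs_def] by (intro holomorphic_intros holomorphic_V)

lemma integrable_sigma:
  assumes "Im z > 0"
  shows "integrable m (\<lambda>x. (1 + x^2) / (cmod (z - complex_of_real x))^2)"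
proof -
  have "integrable m (\<lambda>x. (- 1 / Im z) * Im (nevanlinna_kernel z x))"
    using integrable_nevanlinna_kernel[OF assms] by auto
  moreover have "(- 1 / Im z) * Im (nevanlinna_kernel z x) = (1 + x^2) / (cmod (z - complex_of_real x))^2" for x
    unfolding Im_nevanlinna_kernel[OF assms] mult.assoc[symmetric] using assms by simp
  ultimately show ?thesis by (simp only:)
qed

lemma Im_V:
  assumes "Im z > 0"
  shows "Im (V z) = - Im z * \<sigma> z"
proof -
  have "Im (V z) = (LINT x|m. Im (nevanlinna_kernel z x))"
    using integrable_nevanlinna_kernel[OF assms] by (simp add: V_def)
  then show ?thesis
    unfolding Im_nevanlinna_kernel[OF assms] \<sigma>_def integral_mult_right_zero .
qed

lemma sigma_nonneg: "\<sigma> z \<ge> 0"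
  unfolding \<sigma>_def by (rule Bochner_Integration.integral_nonneg) (simp add: add_nonneg_nonneg)

lemma Im_H: "Im z > 0 \<Longrightarrow> Im (H z) = Im z * (1 - \<sigma> z)"
  by (simp add: H_def Im_V algebra_simps)

lemma Im_H_le: "Im z > 0 \<Longrightarrow> Im (H z) \<le> Im z"
  using sigma_nonneg[of z] by (simp add: H_def Im_V)

lemma Omega_iff: "z \<in> \<Omega> \<longleftrightarrow> Im z > 0 \<and> \<sigma> z < 1"
  by (auto simp: \<Omega>_def Im_H zero_less_mult_iff)

lemma open_Omega: "open \<Omega>"
proof -
  have "open (H -` upper_half_plane \<inter> upper_half_plane)"
    using continuous_open_preimage[OF _ open_upper_half_plane open_upper_half_plane, of H]
      holomorphic_on_imp_continuous_on[OF holomorphic_H] by (simp add: Int_commute)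
  moreover have "\<Omega> = H -` upper_half_plane \<inter> upper_half_plane"
    by (auto simp: \<Omega>_def)
  ultimately show ?thesis by simp
qed

text \<open>On \<open>\<Omega>\<close> the difference quotient of \<^term>\<open>V\<close> has modulus below 1: by AM-GM it is at most
  the mean of \<open>\<sigma>\<close> at the two points.\<close>

lemma inj_on_H: "inj_on H \<Omega>"
proof (rule inj_onI, rule ccontr)
  fix w z assume wz: "w \<in> \<Omega>" "z \<in> \<Omega>" "H w = H z" "w \<noteq> z"
  then have w: "Im w > 0" "\<sigma> w < 1" and z: "Im z > 0" "\<sigma> z < 1" by (auto simp: Omega_iff)
  let ?q = "\<lambda>x. (1 + complex_of_real x^2) / ((w - complex_of_real x) * (z - complex_of_real x))"
  have q_eq: "?q x = (- 1 / (w - z)) * (nevanlinna_kernel w x - nevanlinna_kernel z x)" for x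
  proof -
    have "(- 1 / (w - z)) * (- (w - z)) = 1" using wz(4) by (simp add: divide_simps)
    then show ?thesis
      by (simp only: nevanlinna_kernel_diff[OF w(1) z(1)] mult.assoc[symmetric] mult_1_left)
  qed
  have q_int: "integrable m ?q"
    unfolding q_eq using integrable_nevanlinna_kernel[OF w(1)] integrable_nevanlinna_kernel[OF z(1)] by auto
  have "V w - V z = (CLINT x|m. nevanlinna_kernel w x - nevanlinna_kernel z x)"
    using integrable_nevanlinna_kernel[OF w(1)] integrable_nevanlinna_kernel[OF z(1)]
    by (simp add: V_def)
  also have "\<dots> = - (w - z) * (CLINT x|m. ?q x)"
    unfolding nevanlinna_kernel_diff[OF w(1) z(1)] integral_mult_right_zero ..
  finally have "V w - V z = - (w - z) * (CLINT x|m. ?q x)" .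
  \<comment> \<open>Equal images force the integral of \<open>?q\<close> to be exactly 1, which the
    strict bound by the mean of \<open>\<sigma> w\<close> and \<open>\<sigma> z\<close> rules
    out.\<close>
  moreover have "V w - V z = - (w - z)"
    using wz(3) by (simp add: H_def algebra_simps)
  ultimately have "(CLINT x|m. ?q x) = 1" using wz(4) by simp
  then have "1 = cmod (CLINT x|m. ?q x)" by simp
  also have "\<dots> \<le> (LINT x|m. ((1 + x^2) / (cmod (w - complex_of_real x))^2
        + (1 + x^2) / (cmod (z - complex_of_real x))^2) / 2)"
  proof (rule Bochner_Integration.integral_norm_bound_integral[OF q_int])
    show "integrable m (\<lambda>x. ((1 + x^2) / (cmod (w - complex_of_real x))^2
        + (1 + x^2) / (cmod (z - complex_of_real x))^2) / 2)"
      using integrable_sigma w z by auto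
    fix x
    define p q where "p = 1 / cmod (w - complex_of_real x)" and "q = 1 / cmod (z - complex_of_real x)"
    have "cmod (1 + complex_of_real x^2) = 1 + x^2"
    proof -
      have "1 + complex_of_real x^2 = complex_of_real (1 + x^2)" by simp
      also have "cmod \<dots> = 1 + x^2" by (simp only: norm_of_real) (simp add: add_nonneg_nonneg)
      finally show ?thesis .
    qed
    then have "cmod (?q x) = (1 + x^2) * (p * q)"
      by (simp add: p_def q_def norm_divide norm_mult)
    also have "\<dots> \<le> (1 + x^2) * ((p^2 + q^2) / 2)"
      using sum_squares_bound[of p q] by (intro mult_left_mono) (auto simp: add_nonneg_nonneg)
    also have "\<dots> = ((1 + x^2) / (cmod (w - complex_of_real x))^2
        + (1 + x^2) / (cmod (z - complex_of_real x))^2) / 2"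
      by (simp add: p_def q_def power_divide algebra_simps add_divide_distrib)
    finally show "cmod (?q x) \<le> \<dots>" .
  qed
  also have "\<dots> = (\<sigma> w + \<sigma> z) / 2"
    unfolding \<sigma>_def using integrable_sigma w z by simp
  also have "\<dots> < 1" using w z by simp
  finally show False by simp
qed

text \<open>The kernel bound is integrated over \<open>m\<close>: the part inside \<open>K\<close>
  gives a constant, negligible for large \<open>w\<close>; the tail beyond \<open>K\<close> has
  small mass; the remaining part is \<open>\<eta> * \<sigma> w\<close>, small because
  \<open>\<sigma> w \<le> B\<close>.\<close>

lemma V_growth:
  assumes \<epsilon>: "\<epsilon> > 0" and B: "B \<ge> 0"
  obtains R where "R \<ge> 1"
    "\<And>w. Im w > 0 \<Longrightarrow> cmod w \<ge> R \<Longrightarrow> \<sigma> w \<le> B \<Longrightarrow> cmod (V w) \<le> \<epsilon> * cmod w"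
proof -
  \<comment> \<open>Error budget per unit of \<open>cmod w\<close>: \<open>\<epsilon> / 4\<close>
    for \<open>\<eta> * \<sigma> w\<close>, \<open>\<epsilon> / 4\<close> for the tail term
    \<open>T / (2 * \<eta>)\<close>, and \<open>\<epsilon> / 2\<close> for the constant
    \<open>C\<close>, the last one through the choice of \<open>R\<close>. The summand 1 in
    \<open>B + 1\<close> covers \<open>B = 0\<close>.\<close>
  define \<eta> where "\<eta> = \<epsilon> / (4 * (B + 1))"
  have \<eta>: "\<eta> > 0" "\<eta> * B \<le> \<epsilon> / 4"
    using \<epsilon> B by (auto simp: \<eta>_def field_simps)
  have "\<forall>\<^sub>F n in sequentially. measure m {x. \<bar>x\<bar> > real n} < \<epsilon> * \<eta> / 2"
    using order_tendstoD(2)[OF measure_tail_tendsto_0, of "\<epsilon> * \<eta> / 2"] \<epsilon> \<eta> by simp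
  then obtain n where n: "measure m {x. \<bar>x\<bar> > real n} < \<epsilon> * \<eta> / 2"
    by (auto simp: eventually_sequentially)
  define K where "K = real n"
  define T where "T = measure m {x. \<bar>x\<bar> > K}"
  have T: "T / (2 * \<eta>) \<le> \<epsilon> / 4"
    using n \<eta>(1) by (simp add: T_def K_def field_simps)
  define C where "C = \<bar>a\<bar> + (2 + 2 * K) * measure m (space m)"
  have K0: "K \<ge> 0" by (simp add: K_def)
  define R where "R = max 1 (max (2 * K) (2 * C / \<epsilon>))"
  show ?thesis
  proof
    show "R \<ge> 1" by (simp add: R_def)
    fix w assume w: "Im w > 0" "cmod w \<ge> R" "\<sigma> w \<le> B"
    then have w': "cmod w \<ge> 1" "cmod w \<ge> 2 * K" "C \<le> \<epsilon> / 2 * cmod w"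
      using \<epsilon> by (auto simp: R_def field_simps)
    let ?b = "\<lambda>x. (2 + 2 * K) + cmod w * (1 / (2 * \<eta>) * indicator {x. \<bar>x\<bar> > K} x
        + \<eta> * ((1 + x^2) / (cmod (w - complex_of_real x))^2))"
    have i1: "integrable m (indicator {x. \<bar>x\<bar> > K} :: real \<Rightarrow> real)"
      using emeasure_finite[of "{x. \<bar>x\<bar> > K}"]
      by (intro integrable_real_indicator) (auto simp: M_is_borel less_top[symmetric])
    have ib: "integrable m (\<lambda>x. 1 / (2 * \<eta>) * indicator {x. \<bar>x\<bar> > K} x
        + \<eta> * ((1 + x^2) / (cmod (w - complex_of_real x))^2))"
      by (intro Bochner_Integration.integrable_add integrable_mult_right i1 integrable_sigma w)
    have "cmod (V w) \<le> \<bar>a\<bar> + cmod (CLINT x|m. nevanlinna_kernel w x)"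
      unfolding V_def using norm_triangle_ineq[of "complex_of_real a"] by simp
    also have "cmod (CLINT x|m. nevanlinna_kernel w x) \<le> (LINT x|m. ?b x)"
      by (rule Bochner_Integration.integral_norm_bound_integral[OF integrable_nevanlinna_kernel[OF w(1)]])
         (intro Bochner_Integration.integrable_add integrable_const integrable_mult_right ib
            norm_nevanlinna_kernel_le w w' \<eta>(1) K0)+
    also have "(LINT x|m. ?b x) = (2 + 2 * K) * measure m (space m) + cmod w * (T / (2 * \<eta>) + \<eta> * \<sigma> w)"
    proof -
      have "(LINT x|m. ?b x) = (2 + 2 * K) * measure m (space m) + cmod w *
        (LINT x|m. 1 / (2 * \<eta>) * indicator {x. \<bar>x\<bar> > K} x
        + \<eta> * ((1 + x^2) / (cmod (w - complex_of_real x))^2))"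
        by (subst Bochner_Integration.integral_add[OF integrable_const integrable_mult_right[OF ib]])
           (simp only: integral_mult_right_zero lebesgue_integral_const real_scaleR_def mult.commute)
      also have "(LINT x|m. 1 / (2 * \<eta>) * indicator {x. \<bar>x\<bar> > K} x
        + \<eta> * ((1 + x^2) / (cmod (w - complex_of_real x))^2))
        = 1 / (2 * \<eta>) * (LINT x|m. indicator {x. \<bar>x\<bar> > K} x) + \<eta> * \<sigma> w"
        unfolding \<sigma>_def
        by (subst Bochner_Integration.integral_add[OF integrable_mult_right[OF i1]
              integrable_mult_right[OF integrable_sigma[OF w(1)]]])
           (simp only: integral_mult_right_zero)
      also have "(LINT x|m. indicator {x. \<bar>x\<bar> > K} x) = T"
        by (simp add: T_def sets_eq_imp_space_eq[OF M_is_borel])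
      finally show ?thesis by simp
    qed
    also have "\<bar>a\<bar> + \<dots> = C + cmod w * (T / (2 * \<eta>) + \<eta> * \<sigma> w)" by (simp add: C_def)
    also have "\<dots> \<le> \<epsilon> / 2 * cmod w + cmod w * (\<epsilon> / 4 + \<epsilon> / 4)"
      using w'(3) T order_trans[OF mult_left_mono[OF w(3) less_imp_le[OF \<eta>(1)]] \<eta>(2)]
      by (intro add_mono mult_left_mono) simp_all
    also have "\<dots> = \<epsilon> * cmod w" by (simp add: algebra_simps)
    finally show "cmod (V w) \<le> \<epsilon> * cmod w" by simp
  qed
qed

section \<open>Behaviour of \<open>V\<close> and \<open>H\<close> on truncated cones\<close>

lemma sigma_le_on_cone:
  assumes "z \<in> trunc_cone 1 1"
  shows "\<sigma> z \<le> 10 * measure m (space m)"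
proof -
  have z: "Im z > 1" "\<bar>Re z\<bar> < Im z" using assms by (auto simp: trunc_cone_def)
  have "\<sigma> z \<le> (LINT x|m. 10)"
    unfolding \<sigma>_def
  proof (rule integral_mono)
    show "integrable m (\<lambda>x. (1 + x^2) / (cmod (z - complex_of_real x))^2)"
      using z by (intro integrable_sigma) auto
    fix x
    define d where "d = cmod (z - complex_of_real x)"
    have d: "Im z \<le> d" by (simp add: d_def Im_le_cmod_diff_of_real)
    \<comment> \<open>On this cone \<open>cmod z \<le> 2 * Im z \<le> 2 * d\<close>, hence
      \<open>\<bar>x\<bar> \<le> 3 * d\<close>. The constant is \<open>10 = 9 + 1\<close>, where the
      1 comes from \<open>1 \<le> d^2\<close>.\<close>
    have "\<bar>x\<bar> \<le> d + cmod z"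
      unfolding d_def using norm_triangle_ineq4[of z "z - complex_of_real x"] by simp
    moreover have "cmod z \<le> 2 * Im z"
      using cmod_le[of z] z by simp
    ultimately have "\<bar>x\<bar> \<le> 3 * d" using d by simp
    then have "x^2 \<le> (3 * d)^2" using power_mono[of "\<bar>x\<bar>" "3 * d" 2] by simp
    moreover have "1 \<le> d^2" using d z by (simp add: one_le_power)
    ultimately have "1 + x^2 \<le> 10 * d^2" by (simp add: power_mult_distrib)
    then show "(1 + x^2) / (cmod (z - complex_of_real x))^2 \<le> 10"
      using d z unfolding d_def[symmetric] by (subst pos_divide_le_eq) auto
  qed auto
  then show ?thesis by simp
qed


lemma V_small_on_cone:
  assumes "\<epsilon> > 0"
  obtains \<beta> where "\<beta> \<ge> 1" "\<And>z. z \<in> trunc_cone 1 \<beta> \<Longrightarrow> cmod (V z) \<le> \<epsilon> * Im z"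
proof -
  have pos: "\<epsilon> / 2 > 0" "10 * measure m (space m) \<ge> 0" using assms by auto
  obtain R where R: "R \<ge> 1"
    "\<And>w. Im w > 0 \<Longrightarrow> cmod w \<ge> R \<Longrightarrow> \<sigma> w \<le> 10 * measure m (space m) \<Longrightarrow> cmod (V w) \<le> \<epsilon> / 2 * cmod w"
    by (rule V_growth[OF pos]) blast
  show ?thesis
  proof
    show "R \<ge> 1" by (rule R)
    fix z assume z: "z \<in> trunc_cone 1 R"
    then have z1: "z \<in> trunc_cone 1 1" and Imz: "Im z > R" "\<bar>Re z\<bar> < Im z"
      using R(1) by (auto simp: trunc_cone_def)
    have "cmod (V z) \<le> \<epsilon> / 2 * cmod z"
      using Imz R(1) abs_Im_le_cmod[of z] by (intro R(2) sigma_le_on_cone z1) auto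
    also have "\<dots> \<le> \<epsilon> / 2 * (2 * Im z)"
      using cmod_le[of z] Imz assms by (intro mult_left_mono) auto
    finally show "cmod (V z) \<le> \<epsilon> * Im z" by simp
  qed
qed

text \<open>If \<open>cmod (V z) \<le> Im z / 2\<close>, then
  \<open>Im (H z) \<ge> Im z / 2 > 1 / 2\<close> and
  \<open>\<bar>Re (H z)\<bar> < 3 / 2 * Im z \<le> 3 * Im (H z)\<close>; this explains the target
  cone.\<close>

lemma H_cone:
  obtains \<beta> where "\<beta> \<ge> 1" "trunc_cone 1 \<beta> \<subseteq> \<Omega>" "H ` trunc_cone 1 \<beta> \<subseteq> trunc_cone 3 (1 / 2)"
proof -
  obtain \<beta> where \<beta>: "\<beta> \<ge> 1" "\<And>z. z \<in> trunc_cone 1 \<beta> \<Longrightarrow> cmod (V z) \<le> 1 / 2 * Im z"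
    using V_small_on_cone[of "1 / 2"] by auto
  have "z \<in> \<Omega> \<and> H z \<in> trunc_cone 3 (1 / 2)" if z: "z \<in> trunc_cone 1 \<beta>" for z
  proof -
    have "Im z > 1" "\<bar>Re z\<bar> < Im z" using z \<beta>(1) by (auto simp: trunc_cone_def)
    moreover have "\<bar>Re (V z)\<bar> \<le> 1 / 2 * Im z" "\<bar>Im (V z)\<bar> \<le> 1 / 2 * Im z"
      using \<beta>(2)[OF z] abs_Re_le_cmod[of "V z"] abs_Im_le_cmod[of "V z"] by auto
    ultimately show ?thesis by (auto simp: \<Omega>_def trunc_cone_def H_def)
  qed
  then show ?thesis using \<beta>(1) that by blast
qed

text \<open>The image is open by the open mapping theorem, and relatively closed because
  \<^term>\<open>H\<close> is proper on \<open>\<Omega>\<close> by \<open>V_growth\<close>.\<close>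

lemma image_H: "H ` \<Omega> = upper_half_plane"
proof -
  have sub: "\<Omega> \<subseteq> upper_half_plane" "H ` \<Omega> \<subseteq> upper_half_plane" by (auto simp: \<Omega>_def)
  have "open (H ` \<Omega>)"
    by (rule open_mapping_thm3[OF _ open_Omega inj_on_H])
       (rule holomorphic_on_subset[OF holomorphic_H sub(1)])
  then have op: "openin (top_of_set upper_half_plane) (H ` \<Omega>)"
    using sub(2) by (intro open_openin_trans open_upper_half_plane)
  have "z \<in> H ` \<Omega>" if z: "z islimpt H ` \<Omega>" "Im z > 0" for z
  proof -
    obtain f where f: "\<And>n. f n \<in> H ` \<Omega>" "f \<longlonglongrightarrow> z"
      using z(1) unfolding islimpt_sequential by blast
    have "\<forall>n. \<exists>w. w \<in> \<Omega> \<and> f n = H w" using f(1) by blast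
    from choice[OF this] obtain w where w: "\<And>n. w n \<in> \<Omega>" "\<And>n. f n = H (w n)" by blast
    obtain R where R: "R \<ge> 1"
      "\<And>w. Im w > 0 \<Longrightarrow> cmod w \<ge> R \<Longrightarrow> \<sigma> w \<le> 1 \<Longrightarrow> cmod (V w) \<le> 1 / 2 * cmod w"
      using V_growth[of "1/2" 1] by auto
    obtain C where C: "\<And>n. cmod (f n) \<le> C"
      using convergent_imp_bounded[OF f(2)] by (auto simp: bounded_iff)
    \<comment> \<open>Beyond \<open>R\<close> the growth bound gives
      \<open>cmod (H w) \<ge> cmod w / 2\<close>, so a preimage of a point of modulus at most
      \<open>C\<close> has modulus at most \<open>2 * C\<close>.\<close>
    have "cmod (w n) \<le> max R (2 * C)" for n
    proof (cases "cmod (w n) \<ge> R")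
      case True
      have "cmod (V (w n)) \<le> 1 / 2 * cmod (w n)"
        using w(1)[of n] True by (intro R(2)) (auto simp: Omega_iff)
      moreover have "cmod (w n) - cmod (V (w n)) \<le> cmod (f n)"
        unfolding w(2) H_def using norm_diff_ineq[of "w n" "V (w n)"] by simp
      ultimately show ?thesis using C[of n] by simp
    qed auto
    then have "bounded (range w)" by (auto simp: bounded_iff)
    then obtain l r where lr: "strict_mono r" "(w \<circ> r) \<longlonglongrightarrow> l"
      using bounded_imp_convergent_subsequence by blast
    have fr: "(\<lambda>n. f (r n)) \<longlonglongrightarrow> z"
      using LIMSEQ_subseq_LIMSEQ[OF f(2) lr(1)] by (simp add: o_def)
    \<comment> \<open>\<open>H\<close> does not raise imaginary parts, so preimages of points near
      \<open>z\<close> cannot sink to the real axis.\<close>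
    have "Im z \<le> Im l"
    proof (rule LIMSEQ_le)
      show "(\<lambda>n. Im (f (r n))) \<longlonglongrightarrow> Im z" by (intro tendsto_intros fr)
      show "(\<lambda>n. Im (w (r n))) \<longlonglongrightarrow> Im l" using lr(2) by (intro tendsto_intros) (simp add: o_def)
      show "\<exists>N. \<forall>n\<ge>N. Im (f (r n)) \<le> Im (w (r n))"
        using w Im_H_le by (auto simp: Omega_iff)
    qed
    then have l: "Im l > 0" using z(2) by simp
    have "isCont H l"
      using holomorphic_on_imp_continuous_on[OF holomorphic_H] l open_upper_half_plane
      by (simp add: continuous_on_eq_continuous_at)
    then have "(\<lambda>n. f (r n)) \<longlonglongrightarrow> H l"
      using isCont_tendsto_compose[of l H "w \<circ> r" sequentially] lr(2) by (simp add: w(2))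
    then have "H l = z" using fr LIMSEQ_unique by blast
    then show ?thesis using l z(2) by (auto simp: \<Omega>_def)
  qed
  then have cl: "closedin (top_of_set upper_half_plane) (H ` \<Omega>)"
    using sub(2) unfolding closedin_limpt by auto
  obtain \<beta> where \<beta>: "\<beta> \<ge> 1" "trunc_cone 1 \<beta> \<subseteq> \<Omega>" by (rule H_cone)
  have "\<i> * complex_of_real (\<beta> + 1) \<in> trunc_cone 1 \<beta>"
    using \<beta>(1) by (simp add: trunc_cone_def)
  then have "H ` \<Omega> \<noteq> {}" using \<beta>(2) by blast
  then show ?thesis
    using op cl connected_upper_half_plane unfolding connected_clopen by blast
qed

text \<open>For the limit put \<open>w = F (i y)\<close>. Then \<open>i y / w = 1 + V w / w\<close>,
  and \<open>V_growth\<close> applies because \<open>w\<close> lies in \<open>\<Omega>\<close> and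
  \<open>cmod w \<ge> Im w \<ge> y\<close>; no control of the direction of \<open>w\<close> is
  involved.\<close>

lemma obtain_inverse_H:
  obtains F where "F holomorphic_on upper_half_plane"
    "\<And>z. z \<in> \<Omega> \<Longrightarrow> F (H z) = z" "\<And>z. Im z > 0 \<Longrightarrow> F z \<in> \<Omega>" "\<And>z. Im z > 0 \<Longrightarrow> H (F z) = z"
    "((\<lambda>y. \<i> * complex_of_real y / F (\<i> * complex_of_real y)) \<longlongrightarrow> 1) at_top"
proof -
  have "\<Omega> \<subseteq> upper_half_plane" by (auto simp: \<Omega>_def)
  then have hol: "H holomorphic_on \<Omega>"
    by (rule holomorphic_on_subset[OF holomorphic_H])
  have "\<exists>F. F holomorphic_on H ` \<Omega> \<and> (\<forall>z\<in>\<Omega>. F (H z) = z)"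
    by (rule holomorphic_has_inverse[OF hol open_Omega inj_on_H]) (rule exI, rule conjI, assumption, simp)
  then obtain F where F: "F holomorphic_on H ` \<Omega>" "\<And>z. z \<in> \<Omega> \<Longrightarrow> F (H z) = z"
    by blast
  have F': "F z \<in> \<Omega>" "H (F z) = z" if "Im z > 0" for z
  proof -
    have "z \<in> H ` \<Omega>" using that image_H by simp
    then obtain w where "w \<in> \<Omega>" "z = H w" by blast
    then show "F z \<in> \<Omega>" "H (F z) = z" using F(2) by auto
  qed
  have "((\<lambda>y. \<i> * complex_of_real y / F (\<i> * complex_of_real y)) \<longlongrightarrow> 1) at_top"
  proof (rule tendstoI)
    fix e :: real assume e: "e > 0"
    then have e2: "e / 2 > 0" by simp
    obtain R where R: "R \<ge> 1"
      "\<And>w. Im w > 0 \<Longrightarrow> cmod w \<ge> R \<Longrightarrow> \<sigma> w \<le> 1 \<Longrightarrow> cmod (V w) \<le> e / 2 * cmod w"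
      by (rule V_growth[OF e2 zero_le_one]) blast
    have "dist (\<i> * complex_of_real y / F (\<i> * complex_of_real y)) 1 < e" if y: "y \<ge> R" for y
    proof -
      let ?w = "F (\<i> * complex_of_real y)"
      have y0: "Im (\<i> * complex_of_real y) > 0" using y R(1) by simp
      note w = F'[OF y0]
      have Imw: "Im ?w \<ge> y" using Im_H_le[of ?w] w by (simp add: Omega_iff)
      have "cmod (V ?w) \<le> e / 2 * cmod ?w"
        using w(1) Imw y abs_Im_le_cmod[of ?w] by (intro R(2)) (auto simp: Omega_iff)
      moreover have w0: "cmod ?w > 0" using Imw y R(1) by auto
      moreover have "\<i> * complex_of_real y / ?w - 1 = V ?w / ?w"
        using w0 w(2) by (simp add: H_def field_simps)
      ultimately have "dist (\<i> * complex_of_real y / ?w) 1 \<le> e / 2"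
        by (simp add: dist_norm norm_divide divide_simps)
      then show ?thesis using e by simp
    qed
    then show "\<forall>\<^sub>F y in at_top. dist (\<i> * complex_of_real y / F (\<i> * complex_of_real y)) 1 < e"
      unfolding eventually_at_top_linorder by blast
  qed
  then show ?thesis using F F' image_H by (intro that[of F]) auto
qed

end

section \<open>Herglotz and Nevanlinna representations\<close>

text \<open>\<open>x\<close> is \<open>- cot (\<theta> / 2)\<close>, the real point that the Cayley
  transform sends to \<open>cis \<theta>\<close>. Substituting
  \<open>u = (X - \<i>) / (X + \<i>)\<close> carries the Herglotz kernel of the disc to the
  half-plane kernel.\<close>

lemma cayley_identities:
  assumes z: "Im z > 0" and c: "cos \<theta> \<noteq> 1"
  defines "x \<equiv> - sin \<theta> / (1 - cos \<theta>)" and "\<zeta> \<equiv> (z - \<i>) / (z + \<i>)"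
  shows "cis \<theta> / (cis \<theta> - \<zeta>) = \<i> / 2 * (nevanlinna_kernel z x - \<i>)"
    and "1 + x^2 = 2 / (1 - cos \<theta>)"
proof -
  have c1: "1 - cos \<theta> > 0" using c cos_le_one[of \<theta>] by linarith
  have sc: "sin \<theta> * sin \<theta> = (1 - cos \<theta>) * (1 + cos \<theta>)"
    using sin_cos_squared_add[of \<theta>] by (simp add: power2_eq_square algebra_simps)
  show "1 + x^2 = 2 / (1 - cos \<theta>)"
  proof -
    have "x^2 = (1 - cos \<theta>) * (1 + cos \<theta>) / (1 - cos \<theta>)^2"
      using sc by (simp add: x_def power_divide power2_eq_square)
    also have "\<dots> = (1 + cos \<theta>) / (1 - cos \<theta>)"
      using c1 by (simp add: power2_eq_square)
    finally show ?thesis using c1 by (simp add: field_simps)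
  qed
  have "x * sin \<theta> = - (sin \<theta> * sin \<theta>) / (1 - cos \<theta>)" by (simp add: x_def)
  then have x: "x * (1 - cos \<theta>) = - sin \<theta>" "x * sin \<theta> = - (1 + cos \<theta>)"
    using c1 unfolding sc by (simp_all add: x_def)
  define u where "u = cis \<theta>"
  define X where "X = complex_of_real x"
  have ux: "u * (X + \<i>) = X - \<i>"
    using x by (simp add: u_def X_def complex_eq_iff algebra_simps)
  have u1: "u \<noteq> 1" using c by (auto simp: u_def complex_eq_iff)
  have Xi: "X + \<i> \<noteq> 0" by (auto simp: X_def complex_eq_iff)
  have zi: "z + \<i> \<noteq> 0" using z by (auto simp: complex_eq_iff)
  have zX: "z - X \<noteq> 0" using z by (auto simp: X_def complex_eq_iff)
  have u_eq: "u = (X - \<i>) / (X + \<i>)" using ux Xi by (simp add: field_simps)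
  have "u - \<zeta> = 2 * \<i> * (X - z) / ((X + \<i>) * (z + \<i>))"
    unfolding u_eq \<zeta>_def using Xi zi by (simp add: divide_simps) (simp add: algebra_simps)
  then have "u / (u - \<zeta>) = (X - \<i>) * (z + \<i>) / (2 * \<i> * (X - z))"
    using Xi zi by (simp add: u_eq)
  also have "\<dots> = \<i> / 2 * ((X - \<i>) * (z + \<i>) / (z - X))"
    using zX by (simp add: divide_simps) (simp add: algebra_simps)
  also have "(X - \<i>) * (z + \<i>) / (z - X) = nevanlinna_kernel z x - \<i>"
    using zX by (simp add: nevanlinna_kernel_def X_def[symmetric] divide_simps) (simp add: algebra_simps)
  finally show "cis \<theta> / (cis \<theta> - \<zeta>) = \<i> / 2 * (nevanlinna_kernel z x - \<i>)" by (simp add: u_def)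
qed

lemma cauchy_integral_cis:
  fixes k :: "complex \<Rightarrow> complex"
  assumes hol: "k holomorphic_on cball 0 1" and \<zeta>: "cmod \<zeta> < 1"
  shows "((\<lambda>\<theta>. k (cis \<theta>) * (cis \<theta> / (cis \<theta> - \<zeta>))) has_integral complex_of_real (2 * pi) * k \<zeta>) {0..2*pi}"
proof -
  have "((\<lambda>u. k u / (u - \<zeta>)) has_contour_integral (2 * of_real pi * \<i> * k \<zeta>)) (circlepath 0 1)"
    using Cauchy_integral_circlepath_simple[OF hol, of \<zeta>] \<zeta> by simp
  then have "((\<lambda>\<theta>. k (cis \<theta>) / (cis \<theta> - \<zeta>) * \<i> * cis \<theta>) has_integral 2 * of_real pi * \<i> * k \<zeta>) {0..2*pi}"
    unfolding circlepath_def by (subst (asm) has_contour_integral_part_circlepath_iff) auto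
  from has_integral_mult_right[OF this, of "- \<i>"] show ?thesis
    by (rule has_integral_eq_rhs[OF has_integral_eq[rotated]]) (simp_all add: algebra_simps)
qed

text \<open>Write twice the real part as \<open>g + cnj g\<close> on the unit circle. Cauchy's
  formula handles \<open>g\<close>. For \<open>cnj g\<close>, conjugate the formula at 0 for
  \<open>g u / (1 - cnj \<zeta> * u)\<close>: on the circle the conjugate of
  \<open>1 / (1 - cnj \<zeta> * u)\<close> is \<open>u / (u - \<zeta>)\<close>, and only
  \<open>cnj (f 0)\<close> remains.\<close>

lemma schwarz_formula:
  fixes f :: "complex \<Rightarrow> complex" and r :: real and \<zeta> :: complex
  assumes hol: "f holomorphic_on ball 0 1" and r: "0 < r" "r < 1" and \<zeta>: "cmod \<zeta> < 1"
  shows "((\<lambda>\<theta>. complex_of_real (2 * Re (f (r * cis \<theta>))) * (cis \<theta> / (cis \<theta> - \<zeta>)))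
            has_integral 2 * pi * (f (r * \<zeta>) + cnj (f 0))) {0..2*pi}"
proof -
  define g where "g u = f (complex_of_real r * u)" for u
  have hg: "g holomorphic_on cball 0 1"
    unfolding g_def
  proof (rule holomorphic_on_compose_gen[OF _ hol, unfolded o_def])
    show "(*) (complex_of_real r) ` cball 0 1 \<subseteq> ball 0 1"
    proof
      fix v assume "v \<in> (*) (complex_of_real r) ` cball 0 1"
      then obtain u where u: "cmod u \<le> 1" "v = complex_of_real r * u" by auto
      then have "cmod v \<le> r * 1" using r by (simp add: norm_mult)
      then show "v \<in> ball 0 1" using r by simp
    qed
  qed (intro holomorphic_intros)
  have nz: "1 - cnj \<zeta> * u \<noteq> 0" if "cmod u \<le> 1" for u :: complex
  proof
    assume "1 - cnj \<zeta> * u = 0"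
    then have "cmod \<zeta> * cmod u = 1"
      by (metis complex_mod_cnj eq_iff_diff_eq_0 norm_mult norm_one)
    then show False using \<zeta> that mult_left_le[of "cmod u" "cmod \<zeta>"] by simp
  qed
  have "(\<lambda>u. g u / (1 - cnj \<zeta> * u)) holomorphic_on cball 0 1"
    using nz by (intro holomorphic_intros hg) auto
  from cauchy_integral_cis[OF this, of 0]
  have "((\<lambda>\<theta>. g (cis \<theta>) / (1 - cnj \<zeta> * cis \<theta>)) has_integral 2 * pi * f 0) {0..2*pi}"
    by (simp add: g_def)
  then have "((\<lambda>\<theta>. cnj (g (cis \<theta>) / (1 - cnj \<zeta> * cis \<theta>))) has_integral cnj (2 * pi * f 0)) {0..2*pi}"
    by (simp only: has_integral_cnj[unfolded o_def])
  moreover have "cnj (g (cis \<theta>) / (1 - cnj \<zeta> * cis \<theta>)) = cnj (g (cis \<theta>)) * (cis \<theta> / (cis \<theta> - \<zeta>))" for \<theta>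
  proof -
    have "cis \<theta> - \<zeta> = cis \<theta> * (1 - \<zeta> * cis (- \<theta>))"
      by (simp add: algebra_simps cis_mult)
    moreover have "cnj (cis \<theta>) = cis (- \<theta>)" by (simp add: cis_cnj)
    ultimately show ?thesis by simp
  qed
  ultimately have "((\<lambda>\<theta>. cnj (g (cis \<theta>)) * (cis \<theta> / (cis \<theta> - \<zeta>))) has_integral 2 * pi * cnj (f 0)) {0..2*pi}"
    by simp
  from has_integral_add[OF cauchy_integral_cis[OF hg \<zeta>] this]
  show ?thesis
    unfolding distrib_right[symmetric] complex_add_cnj distrib_left[symmetric] by (simp only: g_def)
qed

lemma norm_cis_kernel_le:
  assumes "cmod \<zeta> < 1"
  shows "cmod (cis \<theta> / (cis \<theta> - \<zeta>)) \<le> 1 / (1 - cmod \<zeta>)"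
proof -
  have "1 - cmod \<zeta> \<le> cmod (cis \<theta> - \<zeta>)" using norm_triangle_ineq2[of "cis \<theta>" \<zeta>] by simp
  then show ?thesis using assms by (simp add: norm_divide frac_le)
qed

lemma cis_minus_nonzero: "cmod \<zeta> < 1 \<Longrightarrow> cis \<theta> - \<zeta> \<noteq> 0"
  by (metis eq_iff_diff_eq_0 less_irrefl norm_cis)

lemma continuous_on_cis_kernel:
  "cmod \<zeta> < 1 \<Longrightarrow> continuous_on A (\<lambda>\<theta>. cis \<theta> / (cis \<theta> - \<zeta>))"
  by (intro continuous_intros) (auto simp: cis_minus_nonzero)

lemma borel_measurable_cis_kernel:
  "cmod \<zeta> < 1 \<Longrightarrow> (\<lambda>\<theta>. cis \<theta> / (cis \<theta> - \<zeta>)) \<in> borel_measurable borel"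
  by (intro borel_measurable_continuous_onI continuous_on_cis_kernel)

text \<open>On the circle of radius \<open>r < 1\<close> the function is continuous, so the measure
  is explicit: density \<open>Re (f (r * cis \<theta>)) / (2 * pi * Re (f 0))\<close> on
  \<open>{0..2*pi}\<close>. Its mass is 1 by the case \<open>\<zeta> = 0\<close>, where the kernel
  is 1. The interval open at \<open>-1\<close> contains the support and has the shape required by
  tightness.\<close>

lemma herglotz_representation_radius:
  fixes f :: "complex \<Rightarrow> complex" and r :: real
  assumes hol: "f holomorphic_on ball 0 1" and pos: "\<And>\<zeta>. cmod \<zeta> < 1 \<Longrightarrow> Re (f \<zeta>) > 0"
    and r: "0 < r" "r < 1"
  obtains P :: "real measure" where "real_distribution P" "measure P {-1<..2*pi} = 1"
    "\<And>\<zeta>::complex. cmod \<zeta> < 1 \<Longrightarrow>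
       complex_of_real (2 * Re (f 0)) * (CLINT \<theta>|P. cis \<theta> / (cis \<theta> - \<zeta>)) = f (r * \<zeta>) + cnj (f 0)"
proof -
  define A where "A = Re (f 0)"
  have A: "A > 0" using pos[of 0] by (simp add: A_def)
  let ?I = "{0..2*pi}"
  define e where "e \<theta> = Re (f (r * cis \<theta>)) / (2 * pi * A)" for \<theta>
  define d where "d \<theta> = indicator ?I \<theta> * e \<theta>" for \<theta>
  have in_ball: "r * cis \<theta> \<in> ball 0 1" for \<theta> using r by (simp add: norm_mult)
  have "continuous_on UNIV (\<lambda>\<theta>. f (r * cis \<theta>))"
    by (rule continuous_on_compose2[OF holomorphic_on_imp_continuous_on[OF hol]])
       (use in_ball in \<open>auto intro!: continuous_intros\<close>)
  then have cont_e: "continuous_on UNIV e"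
    unfolding e_def using A by (intro continuous_intros) auto
  have e_pos: "e \<theta> > 0" for \<theta>
    unfolding e_def using pos[of "r * cis \<theta>"] in_ball[of \<theta>] A by simp
  have d_nonneg: "d \<theta> \<ge> 0" for \<theta> using e_pos[of \<theta>] by (simp add: d_def indicator_def)
  have meas_d[measurable]: "d \<in> borel_measurable borel"
    unfolding d_def using borel_measurable_continuous_onI[OF cont_e] by measurable
  define P where "P = density lborel d"
  have int: "(CLINT \<theta>|P. cis \<theta> / (cis \<theta> - \<zeta>)) = (f (r * \<zeta>) + cnj (f 0)) / (2 * A)"
    if \<zeta>: "cmod \<zeta> < 1" for \<zeta> :: complex
  proof -
    let ?h = "\<lambda>\<theta>. e \<theta> *\<^sub>R (cis \<theta> / (cis \<theta> - \<zeta>))"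
    have "(CLINT \<theta>|P. cis \<theta> / (cis \<theta> - \<zeta>)) = (CLINT \<theta>|lborel. d \<theta> *\<^sub>R (cis \<theta> / (cis \<theta> - \<zeta>)))"
      unfolding P_def using borel_measurable_cis_kernel[OF \<zeta>] d_nonneg
      by (subst integral_density) auto
    also have "\<dots> = (CLBINT \<theta>:?I. ?h \<theta>)"
      unfolding set_lebesgue_integral_def d_def by simp
    also have "\<dots> = integral ?I ?h"
      by (intro set_borel_integral_eq_integral borel_integrable_atLeastAtMost' continuous_on_scaleR
            continuous_on_cis_kernel[OF \<zeta>] continuous_on_subset[OF cont_e]) auto
    also have "\<dots> = (f (r * \<zeta>) + cnj (f 0)) / (2 * A)"
    proof (rule integral_unique)
      have "(?h has_integral (1 / (4 * pi * A)) *\<^sub>R (2 * pi * (f (r * \<zeta>) + cnj (f 0)))) ?I"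
        by (rule has_integral_eq[OF _ has_integral_cmul[OF schwarz_formula[OF hol r \<zeta>]]])
           (use A in \<open>simp add: e_def scaleR_conv_of_real field_simps\<close>)
      moreover have "(1 / (4 * pi * A)) *\<^sub>R (2 * pi * (f (r * \<zeta>) + cnj (f 0))) = (f (r * \<zeta>) + cnj (f 0)) / (2 * A)"
        using A by (simp add: scaleR_conv_of_real field_simps)
      ultimately show "(?h has_integral (f (r * \<zeta>) + cnj (f 0)) / (2 * A)) ?I" by simp
    qed
    finally show ?thesis .
  qed
  have "integrable lborel d"
    using borel_integrable_atLeastAtMost'[OF continuous_on_subset[OF cont_e], of 0 "2*pi"]
    by (simp add: set_integrable_def d_def[abs_def])
  moreover have "(LINT \<theta>|lborel. d \<theta>) = 1"
  proof -
    have "complex_of_real (LINT \<theta>|lborel. d \<theta>) = (CLINT \<theta>|lborel. d \<theta> *\<^sub>R (1::complex))"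
      by (simp add: scaleR_conv_of_real)
    also have "\<dots> = (CLINT \<theta>|P. 1)"
      unfolding P_def using d_nonneg by (subst integral_density) auto
    also have "\<dots> = (f 0 + cnj (f 0)) / (2 * A)"
      using int[of 0] by simp
    also have "\<dots> = 1" using A by (simp add: complex_add_cnj A_def)
    finally show ?thesis by (simp only: of_real_eq_1_iff)
  qed
  ultimately have nn: "(\<integral>\<^sup>+\<theta>. ennreal (d \<theta>) \<partial>lborel) = 1"
    using nn_integral_eq_integral[of lborel d] d_nonneg by simp
  show ?thesis
  proof
    have "prob_space P"
      by (rule prob_spaceI) (use nn in \<open>simp add: P_def emeasure_density\<close>)
    then show rd: "real_distribution P"
      by (simp add: real_distribution_def real_distribution_axioms_def P_def)
    have "emeasure P {-1<..2*pi} = (\<integral>\<^sup>+\<theta>. ennreal (d \<theta>) * indicator {-1<..2*pi} \<theta> \<partial>lborel)"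
      unfolding P_def by (subst emeasure_density) auto
    also have "\<dots> = (\<integral>\<^sup>+\<theta>. ennreal (d \<theta>) \<partial>lborel)"
      by (intro nn_integral_cong) (auto simp: d_def indicator_def)
    finally show "measure P {-1<..2*pi} = 1"
      using nn by (simp add: measure_def)
    fix \<zeta> :: complex assume "cmod \<zeta> < 1"
    then show "complex_of_real (2 * Re (f 0)) * (CLINT \<theta>|P. cis \<theta> / (cis \<theta> - \<zeta>)) = f (r * \<zeta>) + cnj (f 0)"
      using A int[of \<zeta>] by (simp add: A_def)
  qed
qed

text \<open>Measures on the circle are carried by angles on the real line, so that tightness on a
  fixed interval yields a weakly convergent subsequence as the radius tends to 1. The kernel is
  bounded, continuous and periodic on the whole line, so mass at 0 and at \<open>2 * pi\<close> may
  coexist in the limit.\<close>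

lemma herglotz_representation:
  fixes f :: "complex \<Rightarrow> complex"
  assumes hol: "f holomorphic_on ball 0 1" and pos: "\<And>\<zeta>. cmod \<zeta> < 1 \<Longrightarrow> Re (f \<zeta>) > 0"
  obtains P :: "real measure" where "real_distribution P"
    "\<And>\<zeta>::complex. cmod \<zeta> < 1 \<Longrightarrow>
       f \<zeta> + cnj (f 0) = complex_of_real (2 * Re (f 0)) * (CLINT \<theta>|P. cis \<theta> / (cis \<theta> - \<zeta>))"
proof -
  \<comment> \<open>The shift by 2 keeps the radius strictly positive at
    \<open>n = 0\<close>.\<close>
  define r where "r n = 1 - 1 / real (n + 2)" for n
  have r: "0 < r n" "r n < 1" for n by (auto simp: r_def)
  have "\<exists>P. real_distribution P \<and> measure P {-1<..2*pi} = 1 \<and> (\<forall>\<zeta>::complex. cmod \<zeta> < 1 \<longrightarrow>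
       complex_of_real (2 * Re (f 0)) * (CLINT \<theta>|P. cis \<theta> / (cis \<theta> - \<zeta>)) = f (r n * \<zeta>) + cnj (f 0))" for n
    by (rule herglotz_representation_radius[OF hol pos r(1)[of n] r(2)[of n]]) auto
  then obtain P where P: "\<And>n. real_distribution (P n)" "\<And>n. measure (P n) {-1<..2*pi} = 1"
    "\<And>n \<zeta>::complex. cmod \<zeta> < 1 \<Longrightarrow> complex_of_real (2 * Re (f 0)) * (CLINT \<theta>|P n. cis \<theta> / (cis \<theta> - \<zeta>))
        = f (r n * \<zeta>) + cnj (f 0)"
    by metis
  have "tight P"
    unfolding tight_def
  proof (intro conjI allI impI exI)
    show "-1 < 2 * pi" using pi_gt_zero by linarith
  qed (auto simp: P(1,2))
  from tight_imp_convergent_subsubsequence[OF this strict_mono_id] obtain s Q where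
    s: "strict_mono s" and Q: "real_distribution Q" "weak_conv_m (P \<circ> s) Q"
    by (auto simp: o_def)
  show ?thesis
  proof
    show "real_distribution Q" by (rule Q)
    fix \<zeta> :: complex assume \<zeta>: "cmod \<zeta> < 1"
    have "(\<lambda>n. CLINT \<theta>|(P \<circ> s) n. cis \<theta> / (cis \<theta> - \<zeta>)) \<longlonglongrightarrow> (CLINT \<theta>|Q. cis \<theta> / (cis \<theta> - \<zeta>))"
    proof (rule weak_conv_imp_integral_bdd_continuous_conv[OF _ Q])
      show "real_distribution ((P \<circ> s) n)" for n using P(1) by simp
      show "isCont (\<lambda>\<theta>. cis \<theta> / (cis \<theta> - \<zeta>)) x" for x
        using continuous_on_cis_kernel[OF \<zeta>, of UNIV] by (simp add: continuous_on_eq_continuous_at)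
      show "cmod (cis \<theta> / (cis \<theta> - \<zeta>)) \<le> 1 / (1 - cmod \<zeta>)" for \<theta>
        by (rule norm_cis_kernel_le[OF \<zeta>])
    qed
    then have "(\<lambda>n. complex_of_real (2 * Re (f 0)) * (CLINT \<theta>|P (s n). cis \<theta> / (cis \<theta> - \<zeta>)))
      \<longlonglongrightarrow> complex_of_real (2 * Re (f 0)) * (CLINT \<theta>|Q. cis \<theta> / (cis \<theta> - \<zeta>))"
      by (intro tendsto_intros) simp
    moreover have "(\<lambda>n. f (r (s n) * \<zeta>) + cnj (f 0)) \<longlonglongrightarrow> f \<zeta> + cnj (f 0)"
    proof (intro tendsto_intros)
      have "r \<longlonglongrightarrow> 1" unfolding r_def by real_asymp
      then have "(\<lambda>n. r (s n)) \<longlonglongrightarrow> 1" using LIMSEQ_subseq_LIMSEQ[OF _ s] by (simp add: o_def)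
      then have "(\<lambda>n. complex_of_real (r (s n)) * \<zeta>) \<longlonglongrightarrow> of_real 1 * \<zeta>" by (intro tendsto_intros)
      moreover have "isCont f \<zeta>"
        using holomorphic_on_imp_continuous_on[OF hol] \<zeta> by (simp add: continuous_on_eq_continuous_at)
      ultimately show "(\<lambda>n. f (complex_of_real (r (s n)) * \<zeta>)) \<longlonglongrightarrow> f \<zeta>"
        by (intro isCont_tendsto_compose[of _ f]) auto
    qed
    ultimately show "f \<zeta> + cnj (f 0) = complex_of_real (2 * Re (f 0)) * (CLINT \<theta>|Q. cis \<theta> / (cis \<theta> - \<zeta>))"
      unfolding P(3)[OF \<zeta>] using LIMSEQ_unique by blast
  qed
qed

text \<open>At \<open>z = i y\<close> the Cayley image is the real number
  \<open>s = (y - 1) / (y + 1)\<close>, and \<open>2 * Re k - 1\<close> is the Poisson kernel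
  \<open>(1 - s^2) / cmod (u - s)^2\<close>. The right-hand side is arranged so that it visibly does
  not decrease in \<open>y\<close>, with limit \<open>2 / (1 - cos \<theta>)\<close>, and equals
  \<open>y^2\<close> where \<open>cos \<theta> = 1\<close>.\<close>

lemma Re_cis_kernel:
  assumes y: "y > 0"
  defines "\<zeta> \<equiv> (\<i> * complex_of_real y - \<i>) / (\<i> * complex_of_real y + \<i>)"
  shows "y * (2 * Re (cis \<theta> / (cis \<theta> - \<zeta>)) - 1) = 2 / ((1 - cos \<theta>) + (1 + cos \<theta>) / y^2)"
proof -
  define s where "s = (y - 1) / (y + 1)"
  have "\<zeta> = (\<i> * complex_of_real (y - 1)) / (\<i> * complex_of_real (y + 1))"
    by (simp add: \<zeta>_def algebra_simps)
  also have "\<dots> = complex_of_real s"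
    by (simp only: s_def of_real_divide) simp
  finally have \<zeta>: "\<zeta> = complex_of_real s" .
  have sy: "s * (y + 1) = y - 1" using y by (simp add: s_def)
  have s1: "\<bar>s\<bar> < 1" using y by (auto simp: s_def abs_less_iff field_simps)
  define c where "c = cos \<theta>"
  have c: "-1 \<le> c" "c \<le> 1" by (simp_all add: c_def)
  have nrm: "(cmod (cis \<theta> - \<zeta>))^2 = 1 - 2 * s * c + s^2"
    using sin_cos_squared_add[of \<theta>] unfolding \<zeta> c_def cmod_power2
    by (simp add: power2_eq_square algebra_simps)
  define D where "D = (y^2 + 1) - (y^2 - 1) * c"
  have "D = (1 - c) * y^2 + (1 + c)" by (simp add: D_def algebra_simps)
  moreover have "\<dots> > 0"
  proof (cases "c = 1")
    case False
    then have "(1 - c) * y^2 > 0" using c y by simp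
    then show ?thesis using c by simp
  qed simp
  ultimately have D: "D > 0" "D = (1 - c) * y^2 + (1 + c)" by auto
  have eqD: "(1 - 2 * s * c + s^2) * (y + 1)^2 = 2 * D"
  proof -
    have "(1 - 2 * s * c + s^2) * (y + 1)^2 = (y + 1)^2 - 2 * c * (s * (y + 1)) * (y + 1) + (s * (y + 1))^2"
      by (simp add: power2_eq_square algebra_simps)
    then show ?thesis unfolding sy by (simp add: D_def power2_eq_square algebra_simps)
  qed
  have N: "1 - 2 * s * c + s^2 = 2 * D / (y + 1)^2"
    using eqD y by (simp add: field_simps)
  have "Re (cis \<theta> / (cis \<theta> - \<zeta>)) = (1 - s * c) / (1 - 2 * s * c + s^2)"
    unfolding nrm[symmetric]
    using sin_cos_squared_add[of \<theta>]
    by (simp add: Re_divide' \<zeta> c_def power2_eq_square algebra_simps cmod_power2)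
  also have "2 * \<dots> - 1 = (1 - s^2) / (1 - 2 * s * c + s^2)"
  proof -
    have *: "2 * (p / q) - 1 = (1 - s^2) / q" if "q > 0" "2 * p = 1 - s^2 + q" for p q :: real
      using that by (simp add: field_simps)
    show ?thesis
      by (rule *) (use N D y in simp_all)
  qed
  also have "1 - s^2 = 4 * y / (y + 1)^2"
    using y by (simp add: s_def power_divide field_simps) (simp add: power2_eq_square algebra_simps)
  also have "4 * y / (y + 1)^2 / (1 - 2 * s * c + s^2) = 2 * y / D"
  proof -
    have "4 * y / e / (2 * D / e) = 2 * y / D" if "e > 0" for e
      using that D(1) by simp
    then show ?thesis unfolding N using y by simp
  qed
  also have "y * (2 * y / D) = 2 / (D / y^2)"
    using y by (simp add: power2_eq_square)
  also have "D / y^2 = (1 - c) + (1 + c) / y^2"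
    using y unfolding D(2) by (simp add: add_divide_distrib)
  finally show ?thesis by (simp add: c_def)
qed

text \<open>Carried to the half-plane, the Herglotz kernel is \<open>(1 + x^2) / (z - x) + x\<close>
  up to constants, so \<open>G\<close> is the Cauchy transform of a reweighted measure plus a
  constant. The limit hypothesis makes that measure finite of mass 1, excludes mass at infinity, and
  forces the constant to vanish.\<close>

lemma cauchy_transform_representation:
  assumes hol: "G holomorphic_on upper_half_plane"
    and neg: "\<And>z. Im z > 0 \<Longrightarrow> Im (G z) < 0"
    and lim: "((\<lambda>y. \<i> * complex_of_real y * G (\<i> * complex_of_real y)) \<longlongrightarrow> 1) at_top"
  obtains \<nu> :: "real measure" where "real_distribution \<nu>"
    "\<And>z. Im z > 0 \<Longrightarrow> G z = cauchy_transform \<nu> z"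
proof -
  \<comment> \<open>The inverse Cayley transform; multiplying \<open>G\<close> by
    \<open>\<i>\<close> turns \<open>Im G < 0\<close> into a positive real part.\<close>
  define M where "M \<zeta> = \<i> * ((1 + \<zeta>) / (1 - \<zeta>))" for \<zeta> :: complex
  define f where "f \<zeta> = \<i> * G (M \<zeta>)" for \<zeta>
  have ne1: "1 - \<zeta> \<noteq> 0" if "cmod \<zeta> < 1" for \<zeta> using that by auto
  have ImM: "Im (M \<zeta>) > 0" if "cmod \<zeta> < 1" for \<zeta>
  proof -
    have "(Re \<zeta>)^2 + (Im \<zeta>)^2 < 1"
      using that by (simp add: cmod_power2[symmetric] power_less_one_iff)
    then have "(1 + Re \<zeta>) * (1 - Re \<zeta>) - Im \<zeta> * Im \<zeta> > 0"
      by (simp add: power2_eq_square algebra_simps)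
    moreover have "(cmod (1 - \<zeta>))^2 > 0" using ne1[OF that] by simp
    moreover have "Im (M \<zeta>) = Re ((1 + \<zeta>) / (1 - \<zeta>))"
      by (simp only: M_def Im_i_times)
    moreover have "\<dots> = ((1 + Re \<zeta>) * (1 - Re \<zeta>) - Im \<zeta> * Im \<zeta>) / (cmod (1 - \<zeta>))^2"
      by (simp add: Re_divide')
    ultimately show ?thesis by simp
  qed
  have "M ` ball 0 1 \<subseteq> upper_half_plane" using ImM by auto
  moreover have "M holomorphic_on ball 0 1"
    unfolding M_def using ne1 by (intro holomorphic_intros) auto
  ultimately have "f holomorphic_on ball 0 1"
    unfolding f_def by (intro holomorphic_intros holomorphic_on_compose_gen[OF _ hol, unfolded o_def])
  moreover have "Re (f \<zeta>) > 0" if "cmod \<zeta> < 1" for \<zeta>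
    using neg[OF ImM[OF that]] by (simp add: f_def)
  ultimately obtain P where P: "real_distribution P"
    "\<And>\<zeta>::complex. cmod \<zeta> < 1 \<Longrightarrow>
       f \<zeta> + cnj (f 0) = complex_of_real (2 * Re (f 0)) * (CLINT \<theta>|P. cis \<theta> / (cis \<theta> - \<zeta>))"
    and A_pos: "Re (f 0) > 0"
    using herglotz_representation[of f] by (metis norm_zero zero_less_one)
  interpret P: real_distribution P by (rule P)
  define A where "A = Re (f 0)"
  have A: "A > 0" using A_pos by (simp add: A_def)
  define Z where "Z z = (z - \<i>) / (z + \<i>)" for z
  have nz: "z + \<i> \<noteq> 0" if "Im z > 0" for z using that by (auto simp: complex_eq_iff)
  have Z: "cmod (Z z) < 1" if "Im z > 0" for z
  proof -
    have "(cmod (z - \<i>))^2 < (cmod (z + \<i>))^2"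
      using that unfolding cmod_power2 by (simp add: power2_eq_square algebra_simps)
    then have "cmod (z - \<i>) < cmod (z + \<i>)" by (rule power_less_imp_less_base) simp
    then show ?thesis using nz[OF that] by (simp add: Z_def norm_divide)
  qed
  have MZ: "M (Z z) = z" if "Im z > 0" for z
  proof -
    have "1 + Z z = 2 * z / (z + \<i>)" "1 - Z z = 2 * \<i> / (z + \<i>)"
      using nz[OF that] by (simp_all add: Z_def field_simps)
    then show ?thesis using nz[OF that] by (simp add: M_def)
  qed
  define k where "k z \<theta> = cis \<theta> / (cis \<theta> - Z z)" for z \<theta>
  have rep: "\<i> * G z + cnj (f 0) = complex_of_real (2 * A) * (CLINT \<theta>|P. k z \<theta>)" if "Im z > 0" for z
    using P(2)[OF Z[OF that]] MZ[OF that] by (simp add: f_def A_def k_def)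
  have meas_k[measurable]: "k z \<in> borel_measurable borel" if "Im z > 0" for z
    unfolding k_def using borel_measurable_cis_kernel[OF Z[OF that]] by simp
  have int_k: "integrable P (k z)" if "Im z > 0" for z
    by (rule P.integrable_const_bound[of _ "1 / (1 - cmod (Z z))"])
       (use norm_cis_kernel_le[OF Z[OF that]] meas_k[OF that] in \<open>auto simp: k_def\<close>)

  text \<open>At \<open>\<i> y\<close> the kernel of \<open>- y Im G\<close> increases to \<open>2 / (1 - cos \<theta>)\<close> as \<open>y\<close> grows, and its
    integral stays bounded: this excludes an atom at \<open>cos \<theta> = 1\<close>, the point that the Cayley
    transform sends to infinity.\<close>
  define q where "q n \<theta> = A * (2 / ((1 - cos \<theta>) + (1 + cos \<theta>) / (real (Suc n))^2))" for n \<theta>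
  have q_eq: "q n \<theta> = real (Suc n) * A * (2 * Re (k (\<i> * complex_of_real (Suc n)) \<theta>) - 1)" for n \<theta>
    unfolding q_def k_def Z_def Re_cis_kernel[of "real (Suc n)" \<theta>, OF of_nat_0_less_iff[THEN iffD2, OF zero_less_Suc], symmetric]
    by (simp only: of_real_of_nat_eq mult_ac)
  have int_q: "integrable P (q n)" for n
    unfolding q_eq[abs_def] using int_k[of "\<i> * complex_of_real (Suc n)"] by auto
  \<comment> \<open>This is \<open>- y * Im (G (i y))\<close> at \<open>y = n + 1\<close>: the real
    part \<open>A\<close> of \<open>cnj (f 0)\<close> is cancelled by the \<open>- 1\<close> in
    \<open>q_eq\<close>. The hypothesis \<open>lim\<close> supplies its limit 1.\<close>
  have "(LINT \<theta>|P. q n \<theta>) = Re (\<i> * complex_of_real (Suc n) * G (\<i> * complex_of_real (Suc n)))" for n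
  proof -
    let ?z = "\<i> * complex_of_real (Suc n)"
    have ik: "integrable P (k ?z)" by (rule int_k) simp
    have "(LINT \<theta>|P. q n \<theta>) = real (Suc n) * A * (LINT \<theta>|P. 2 * Re (k ?z \<theta>) - 1)"
      unfolding q_eq integral_mult_right_zero ..
    also have "(LINT \<theta>|P. 2 * Re (k ?z \<theta>) - 1) = 2 * Re (CLINT \<theta>|P. k ?z \<theta>) - 1"
      using ik by (subst Bochner_Integration.integral_diff) (auto simp: P.prob_space[unfolded P.space_eq_univ])
    also have "real (Suc n) * A * \<dots> = real (Suc n) * (Re (complex_of_real (2 * A) * (CLINT \<theta>|P. k ?z \<theta>)) - A)"
      by (simp add: algebra_simps)
    also have "Re (complex_of_real (2 * A) * (CLINT \<theta>|P. k ?z \<theta>)) = Re (\<i> * G ?z) + A"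
      by (subst rep[symmetric]) (simp_all add: A_def)
    finally show ?thesis by (simp add: algebra_simps)
  qed
  moreover have "(\<lambda>n. Re (\<i> * complex_of_real (Suc n) * G (\<i> * complex_of_real (Suc n)))) \<longlonglongrightarrow> Re 1"
    by (intro tendsto_Re filterlim_compose[OF lim, where f = "\<lambda>n. real (Suc n)"]) real_asymp
  ultimately have lim_q: "(\<lambda>n. LINT \<theta>|P. q n \<theta>) \<longlonglongrightarrow> 1" by simp
  have cos_le: "cos \<theta> \<le> 1" "- 1 \<le> cos \<theta>" for \<theta> :: real by simp_all
  have c_ge: "0 \<le> 1 + cos \<theta>" for \<theta> :: real using cos_le(2)[of \<theta>] by linarith
  have q_nonneg: "q n \<theta> \<ge> 0" for n \<theta>
    using A cos_le[of \<theta>] unfolding q_def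
    by (intro mult_nonneg_nonneg divide_nonneg_nonneg add_nonneg_nonneg[of "1 - cos \<theta>"] c_ge) auto
  define Q where "Q = {\<theta>::real. cos \<theta> = 1}"
  have Q_sets: "Q \<in> sets borel" unfolding Q_def by measurable
  have "P.prob Q = 0"
  proof (rule ccontr)
    assume "P.prob Q \<noteq> 0"
    then have pQ: "P.prob Q > 0" by (simp add: zero_less_measure_iff)
    obtain C where C: "\<And>n. (LINT \<theta>|P. q n \<theta>) \<le> C"
      using convergent_imp_Bseq[of "\<lambda>n. LINT \<theta>|P. q n \<theta>"] lim_q
      unfolding convergent_def Bseq_def by (metis abs_le_D1 real_norm_def)
    \<comment> \<open>On \<open>Q\<close> the function \<open>q n\<close> equals
      \<open>A * (n + 1)^2\<close>, so positive mass there would make the convergent integrals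
      unbounded.\<close>
    have "A * (real (Suc n))^2 * P.prob Q \<le> C" for n
    proof -
      have "A * (real (Suc n))^2 * P.prob Q = (LINT \<theta>|P. A * (real (Suc n))^2 * indicator Q \<theta>)"
        using Q_sets by simp
      also have "\<dots> \<le> (LINT \<theta>|P. q n \<theta>)"
      proof (rule integral_mono[OF _ int_q])
        show "integrable P (\<lambda>\<theta>. A * (real (Suc n))^2 * indicator Q \<theta>)"
          using Q_sets P.emeasure_finite[of Q]
          by (intro integrable_mult_right integrable_real_indicator) (auto simp: less_top[symmetric])
        show "A * (real (Suc n))^2 * indicator Q \<theta> \<le> q n \<theta>" for \<theta>
        proof (cases "\<theta> \<in> Q")
          case True
          then have "q n \<theta> = A * (real (Suc n))^2" by (simp add: q_def Q_def)
          then show ?thesis using True by simp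
        qed (simp add: q_nonneg)
      qed
      finally show ?thesis using C[of n] by linarith
    qed
    moreover have "filterlim (\<lambda>n. A * (real (Suc n))^2 * P.prob Q) at_top sequentially"
      using A pQ by real_asymp
    then have "\<forall>\<^sub>F n in sequentially. A * (real (Suc n))^2 * P.prob Q > C"
      by (simp add: filterlim_at_top_dense)
    ultimately show False
      by (auto simp: eventually_sequentially not_le[symmetric])
  qed
  then have AE_cos: "AE \<theta> in P. cos \<theta> \<noteq> 1"
    using Q_sets by (intro AE_I[of _ _ Q]) (auto simp: Q_def P.emeasure_eq_measure)

  \<comment> \<open>The limit of \<open>q n\<close> off the null set \<open>Q\<close>, where it also
    equals \<open>A * (1 + (X \<theta>)^2)\<close>. On \<open>Q\<close> division by zero gives the
    value 0.\<close>
  define w where "w \<theta> = A * (2 / (1 - cos \<theta>))" for \<theta> :: real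
  have w_nonneg: "w \<theta> \<ge> 0" for \<theta> using A by (simp add: w_def)
  have meas_w[measurable]: "w \<in> borel_measurable borel" unfolding w_def by measurable
  have "integrable P w \<and> (LINT \<theta>|P. w \<theta>) = 1"
  proof (intro conjI)
    have mono: "AE \<theta> in P. mono (\<lambda>n. q n \<theta>)"
      using AE_cos
    proof eventually_elim
      fix \<theta> :: real assume "cos \<theta> \<noteq> 1"
      then have c: "cos \<theta> < 1" using cos_le[of \<theta>] by linarith
      show "mono (\<lambda>n. q n \<theta>)"
      proof (rule monoI)
        fix i j :: nat assume "i \<le> j"
        then show "q i \<theta> \<le> q j \<theta>"
          unfolding q_def using A c cos_le[of \<theta>]
          by (intro mult_left_mono divide_left_mono add_left_mono power_mono
              mult_pos_pos add_pos_nonneg divide_nonneg_nonneg c_ge) auto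
      qed
    qed
    have lim: "AE \<theta> in P. (\<lambda>n. q n \<theta>) \<longlonglongrightarrow> w \<theta>"
      using AE_cos
    proof eventually_elim
      fix \<theta> :: real assume "cos \<theta> \<noteq> 1"
      have "(\<lambda>n. (1 + cos \<theta>) / (real (Suc n))^2) \<longlonglongrightarrow> 0" by real_asymp
      then have "(\<lambda>n. A * (2 / ((1 - cos \<theta>) + (1 + cos \<theta>) / (real (Suc n))^2)))
          \<longlonglongrightarrow> A * (2 / ((1 - cos \<theta>) + 0))"
        using \<open>cos \<theta> \<noteq> 1\<close> by (intro tendsto_intros) auto
      then show "(\<lambda>n. q n \<theta>) \<longlonglongrightarrow> w \<theta>" by (simp only: q_def w_def add_0_right)
    qed
    show "integrable P w"
      by (rule integral_monotone_convergence_nonneg(1)[OF int_q mono _ lim lim_q]) (auto simp: q_nonneg)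
    show "(LINT \<theta>|P. w \<theta>) = 1"
      by (rule integral_monotone_convergence_nonneg(2)[OF int_q mono _ lim lim_q]) (auto simp: q_nonneg)
  qed
  then have int_w: "integrable P w" and w1: "(LINT \<theta>|P. w \<theta>) = 1" by auto

  define X where "X \<theta> = - sin \<theta> / (1 - cos \<theta>)" for \<theta> :: real
  have meas_X[measurable]: "X \<in> borel_measurable borel" unfolding X_def by measurable
  \<comment> \<open>Reweighting by \<open>w\<close> and moving each angle to its real point under
    the inverse Cayley transform.\<close>
  define \<nu> where "\<nu> = distr (density P w) borel X"
  have "emeasure (density P w) (space (density P w)) = 1"
    using w1 nn_integral_eq_integral[OF int_w] w_nonneg by (simp add: emeasure_density)
  then have "prob_space (density P w)" by (rule prob_spaceI)
  then have \<nu>: "real_distribution \<nu>"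
    unfolding \<nu>_def by (rule prob_space.real_distribution_distr) simp
  interpret \<nu>: real_distribution \<nu> by (rule \<nu>)
  have ct_\<nu>: "cauchy_transform \<nu> z = (CLINT \<theta>|P. w \<theta> *\<^sub>R (1 / (z - complex_of_real (X \<theta>))))" for z
    unfolding cauchy_transform_def \<nu>_def
    by (subst integral_distr, simp, simp, subst integral_density) (auto simp: w_nonneg)
  have int_wz: "integrable P (\<lambda>\<theta>. w \<theta> *\<^sub>R (1 / (z - complex_of_real (X \<theta>))))" if "Im z > 0" for z
    using \<nu>.integrable_cauchy_kernel[OF that] unfolding \<nu>_def
    by (subst (asm) integrable_distr_eq, simp, simp, subst (asm) integrable_density) (auto simp: w_nonneg)
  \<comment> \<open>\<open>\<kappa>\<close> and \<open>b\<close> collect every term that does not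
    depend on \<open>z\<close>.\<close>
  define \<kappa> where "\<kappa> = (CLINT \<theta>|P. complex_of_real (A * X \<theta>))"
  define b where "b = (A - cnj (f 0)) / \<i> + \<kappa>"
  have G_eq: "G z = cauchy_transform \<nu> z + b" if z: "Im z > 0" for z
  proof -
    have AE_eq: "AE \<theta> in P. complex_of_real (2 * A) * k z \<theta>
        = \<i> * (w \<theta> *\<^sub>R (1 / (z - complex_of_real (X \<theta>))) + complex_of_real (A * X \<theta>)) + A"
      using AE_cos
    proof eventually_elim
      fix \<theta> :: real assume c: "cos \<theta> \<noteq> 1"
      have w: "w \<theta> = A * (1 + (X \<theta>)^2)"
        using cayley_identities(2)[OF z c] by (simp add: w_def X_def)
      have "complex_of_real (2 * A) * k z \<theta> = \<i> * (A * nevanlinna_kernel z (X \<theta>)) + A"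
        using cayley_identities(1)[OF z c] by (simp add: k_def Z_def X_def algebra_simps)
      also have "A * nevanlinna_kernel z (X \<theta>) = w \<theta> *\<^sub>R (1 / (z - complex_of_real (X \<theta>))) + complex_of_real (A * X \<theta>)"
        unfolding nevanlinna_kernel_eq'[OF z] w by (simp add: scaleR_conv_of_real algebra_simps)
      finally show "complex_of_real (2 * A) * k z \<theta>
        = \<i> * (w \<theta> *\<^sub>R (1 / (z - complex_of_real (X \<theta>))) + complex_of_real (A * X \<theta>)) + A" .
    qed
    \<comment> \<open>\<open>A * X\<close> is the integrable Herglotz kernel, suitably normalised,
      minus the integrable Cauchy integrand, and hence integrable itself.\<close>
    have int_X: "integrable P (\<lambda>\<theta>. complex_of_real (A * X \<theta>))"
    proof (rule Bochner_Integration.integrable_cong_AE_imp)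
      show "integrable P (\<lambda>\<theta>. (complex_of_real (2 * A) * k z \<theta> - A) / \<i>
           - w \<theta> *\<^sub>R (1 / (z - complex_of_real (X \<theta>))))"
        by (intro Bochner_Integration.integrable_diff integrable_divide integrable_mult_right
              int_k[OF z] int_wz[OF z] P.integrable_const)
      show "AE \<theta> in P. (complex_of_real (2 * A) * k z \<theta> - A) / \<i>
           - w \<theta> *\<^sub>R (1 / (z - complex_of_real (X \<theta>))) = complex_of_real (A * X \<theta>)"
        using AE_eq by eventually_elim simp
    qed measurable
    have "\<i> * G z + cnj (f 0) = (CLINT \<theta>|P. complex_of_real (2 * A) * k z \<theta>)"
      using rep[OF z] by simp
    also have "\<dots> = (CLINT \<theta>|P. \<i> * (w \<theta> *\<^sub>R (1 / (z - complex_of_real (X \<theta>))) + complex_of_real (A * X \<theta>)) + A)"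
      by (rule integral_cong_AE) (use AE_eq meas_k[OF z] in auto)
    also have "\<dots> = \<i> * (CLINT \<theta>|P. w \<theta> *\<^sub>R (1 / (z - complex_of_real (X \<theta>))) + complex_of_real (A * X \<theta>)) + A"
      by (subst Bochner_Integration.integral_add[OF
            integrable_mult_right[OF Bochner_Integration.integrable_add[OF int_wz[OF z] int_X]] P.integrable_const])
         (simp only: integral_mult_right_zero lebesgue_integral_const P.prob_space scaleR_one)
    also have "(CLINT \<theta>|P. w \<theta> *\<^sub>R (1 / (z - complex_of_real (X \<theta>))) + complex_of_real (A * X \<theta>))
        = cauchy_transform \<nu> z + \<kappa>"
      unfolding ct_\<nu> \<kappa>_def by (rule Bochner_Integration.integral_add[OF int_wz[OF z] int_X])
    finally have "A - cnj (f 0) = \<i> * (G z - cauchy_transform \<nu> z - \<kappa>)" by (simp add: algebra_simps)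
    then show ?thesis by (simp add: b_def)
  qed
  \<comment> \<open>Along \<open>z = i y\<close> both \<open>G z\<close>, which is
    \<open>z * G z\<close> divided by \<open>z\<close>, and the Cauchy transform tend to 0, so their
    constant difference is 0.\<close>
  have "b = 0"
  proof (rule tendsto_unique[OF trivial_limit_at_top_linorder])
    have inv: "((\<lambda>y. 1 / y) \<longlongrightarrow> (0::real)) at_top" by real_asymp
    have "((\<lambda>y. (\<i> * complex_of_real y * G (\<i> * complex_of_real y)) * (complex_of_real (1 / y) / \<i>)
          - cauchy_transform \<nu> (\<i> * complex_of_real y)) \<longlongrightarrow> 1 * (complex_of_real 0 / \<i>) - 0) at_top"
    proof (intro tendsto_intros lim inv)
      show "((\<lambda>y. cauchy_transform \<nu> (\<i> * complex_of_real y)) \<longlongrightarrow> 0) at_top"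
      proof (rule Lim_null_comparison)
        show "\<forall>\<^sub>F y in at_top. cmod (cauchy_transform \<nu> (\<i> * complex_of_real y)) \<le> 1 / y"
          using eventually_gt_at_top[of 0]
        proof eventually_elim
          fix y :: real assume "y > 0"
          then show "cmod (cauchy_transform \<nu> (\<i> * complex_of_real y)) \<le> 1 / y"
            using \<nu>.norm_cauchy_transform_le[of "\<i> * complex_of_real y"] \<nu>.prob_space by simp
        qed
      qed (rule inv)
    qed simp
    then show "((\<lambda>y. (\<i> * complex_of_real y * G (\<i> * complex_of_real y)) * (complex_of_real (1 / y) / \<i>)
          - cauchy_transform \<nu> (\<i> * complex_of_real y)) \<longlongrightarrow> 0) at_top" by simp
    show "((\<lambda>y. (\<i> * complex_of_real y * G (\<i> * complex_of_real y)) * (complex_of_real (1 / y) / \<i>)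
          - cauchy_transform \<nu> (\<i> * complex_of_real y)) \<longlongrightarrow> b) at_top"
    proof (rule tendsto_eventually)
      show "\<forall>\<^sub>F y in at_top. (\<i> * complex_of_real y * G (\<i> * complex_of_real y)) * (complex_of_real (1 / y) / \<i>)
          - cauchy_transform \<nu> (\<i> * complex_of_real y) = b"
        using eventually_gt_at_top[of 0]
      proof eventually_elim
        fix y :: real assume "y > 0"
        then show "(\<i> * complex_of_real y * G (\<i> * complex_of_real y)) * (complex_of_real (1 / y) / \<i>)
          - cauchy_transform \<nu> (\<i> * complex_of_real y) = b"
          using G_eq[of "\<i> * complex_of_real y"] by (simp add: algebra_simps)
      qed
    qed
  qed
  then show ?thesis using G_eq that[OF \<nu>] by simp
qed

section \<open>Injectivity of the Cauchy transform\<close>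

text \<open>The unnormalised characteristic function of the Cauchy law, that is
  \<open>pi * exp (- \<bar>r\<bar>)\<close>. The argument rests on its continuity at 0 and on
  \<open>cauchy_char 0 \<noteq> 0\<close>.\<close>

definition cauchy_char :: "real \<Rightarrow> complex" where
  "cauchy_char r = (CLINT s|lborel. iexp (r * s) * complex_of_real (1 / (1 + s^2)))"

lemma integrable_inverse_1_plus_sq: "integrable lborel (\<lambda>s::real. 1 / (1 + s^2))"
  using integrable_inverse_1_plus_square
  by (simp add: set_integrable_def einterval_def inverse_eq_divide)

lemma integrable_cauchy_char:
  "integrable lborel (\<lambda>s. iexp (r * s) * complex_of_real (1 / (1 + s^2)))"
proof (rule Bochner_Integration.integrable_bound[OF integrable_inverse_1_plus_sq])
  show "AE s in lborel. cmod (iexp (r * s) * complex_of_real (1 / (1 + s^2))) \<le> norm (1 / (1 + s^2))"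
    by (simp add: norm_mult del: of_real_divide of_real_add)
qed measurable

lemma cauchy_char_tendsto:
  assumes "r \<longlonglongrightarrow> 0"
  shows "(\<lambda>n. cauchy_char (r n)) \<longlonglongrightarrow> cauchy_char 0"
  unfolding cauchy_char_def
proof (rule integral_dominated_convergence[OF _ _ integrable_inverse_1_plus_sq])
  show "AE s in lborel. (\<lambda>n. iexp (r n * s) * complex_of_real (1 / (1 + s^2))) \<longlonglongrightarrow>
          iexp (0 * s) * complex_of_real (1 / (1 + s^2))"
    by (intro AE_I2 tendsto_intros assms)
  show "AE s in lborel. cmod (iexp (r n * s) * complex_of_real (1 / (1 + s^2))) \<le> 1 / (1 + s^2)" for n
    by (simp add: norm_mult del: of_real_divide of_real_add)
qed measurable

lemma cauchy_char_0_nonzero: "cauchy_char 0 \<noteq> 0"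
proof
  assume "cauchy_char 0 = 0"
  then have "complex_of_real (LINT s|lborel. 1 / (1 + s^2)) = 0"
    by (simp add: cauchy_char_def flip: integral_complex_of_real)
  then have "(LINT s|lborel. 1 / (1 + (s::real)^2)) = 0" by (simp only: of_real_eq_0_iff)
  moreover have "(LINT s|lborel. 1 / (1 + (s::real)^2)) = pi"
    using LBINT_inverse_1_plus_square
    by (simp add: interval_lebesgue_integral_def set_lebesgue_integral_def einterval_def inverse_eq_divide)
  ultimately show False by simp
qed

lemma poisson_kernel_affine:
  fixes x y s :: real
  assumes "y > 0"
  shows "y / ((x + y * s - x)^2 + y^2) = (1 / (1 + s^2)) / y"
proof -
  have "(x + y * s - x)^2 + y^2 = y * (y * (1 + s^2))" by (simp add: power2_eq_square algebra_simps)
  then show ?thesis using assms by simp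
qed

text \<open>The substitution \<open>u = x + y * s\<close> reduces the Poisson kernel to
  \<open>1 / (1 + s^2)\<close> and splits off the phase \<open>iexp (t * x)\<close>.\<close>

lemma
  assumes y: "y > 0"
  shows integrable_poisson: "integrable lborel (\<lambda>u. iexp (t * u) * complex_of_real (y / ((u - x)^2 + y^2)))" (is ?I)
    and integral_poisson: "(CLINT u|lborel. iexp (t * u) * complex_of_real (y / ((u - x)^2 + y^2)))
        = iexp (t * x) * cauchy_char (t * y)" (is ?E)
proof -
  let ?f = "\<lambda>u. iexp (t * u) * complex_of_real (y / ((u - x)^2 + y^2))"
  have aff: "?f (x + y * s) = (iexp (t * x) / y) * (iexp (t * y * s) * complex_of_real (1 / (1 + s^2)))" for s
  proof -
    have "iexp (t * (x + y * s)) = iexp (t * x) * iexp (t * y * s)"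
      by (simp add: exp_add[symmetric] algebra_simps)
    then show ?thesis
      unfolding poisson_kernel_affine[OF y] of_real_divide[of _ y] by simp
  qed
  have "integrable lborel (\<lambda>s. ?f (x + y * s))"
    unfolding aff by (intro integrable_mult_right integrable_cauchy_char)
  then show ?I using lborel_integrable_real_affine_iff[of y ?f x] y by simp
  have "(CLINT u|lborel. ?f u) = \<bar>y\<bar> *\<^sub>R (CLINT s|lborel. ?f (x + y * s))"
    using y by (intro lborel_integral_real_affine) simp
  also have "\<dots> = \<bar>y\<bar> *\<^sub>R ((iexp (t * x) / y) * cauchy_char (t * y))"
    unfolding aff cauchy_char_def integral_mult_right_zero ..
  also have "\<dots> = iexp (t * x) * cauchy_char (t * y)"
    using y by (simp add: scaleR_conv_of_real)
  finally show ?E .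
qed

text \<open>\<open>- Im\<close> of the Cauchy transform at height \<open>y\<close> is the
  convolution of \<open>M\<close> with the Poisson kernel, and the Fourier transform turns the
  convolution into a product. Hence the Cauchy transform determines the left-hand side.\<close>

lemma (in real_distribution) char_mult_cauchy_char:
  assumes y: "y > 0"
  shows "char M t * cauchy_char (t * y) =
    (CLINT u|lborel. iexp (t * u) * complex_of_real (- Im (cauchy_transform M (Complex u y))))"
proof -
  let ?f = "\<lambda>x u. iexp (t * u) * complex_of_real (y / ((u - x)^2 + y^2))"
  interpret pair_sigma_finite M lborel ..
  have int: "integrable (M \<Otimes>\<^sub>M lborel) (case_prod ?f)"
  proof (rule Fubini_integrable)
    show "case_prod ?f \<in> borel_measurable (M \<Otimes>\<^sub>M lborel)" by measurable
    \<comment> \<open>The modulus is the Poisson kernel itself; its mass does not depend on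
      \<open>x\<close>, by the case \<open>t = 0\<close> of \<open>integral_poisson\<close>.\<close>
    have "(LINT u|lborel. cmod (case_prod ?f (x, u))) = Re (cauchy_char 0)" for x
    proof -
      have "(LINT u|lborel. cmod (case_prod ?f (x, u))) = (LINT u|lborel. Re (iexp (0 * u) * complex_of_real (y / ((u - x)^2 + y^2))))"
        using y by (intro Bochner_Integration.integral_cong) (auto simp: norm_mult add_nonneg_nonneg simp del: of_real_divide)
      also have "\<dots> = Re (cauchy_char 0)"
        using integral_Re[OF integrable_poisson[OF y, of 0 x]] unfolding integral_poisson[OF y, of 0 x]
        by (simp only: mult_zero_left of_real_0 mult_zero_right exp_zero mult_1_left)
      finally show ?thesis .
    qed
    then show "integrable M (\<lambda>x. LINT u|lborel. cmod (case_prod ?f (x, u)))" by simp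
    show "AE x in M. integrable lborel (\<lambda>u. case_prod ?f (x, u))"
      using integrable_poisson[OF y] by simp
  qed
  have inner: "(CLINT x|M. ?f x u) = iexp (t * u) * complex_of_real (- Im (cauchy_transform M (Complex u y)))" for u
  proof -
    have im: "y / ((u - x)^2 + y^2) = - Im (1 / (Complex u y - complex_of_real x))" for x
      by (simp add: Im_divide)
    have "integrable M (\<lambda>x. 1 / (Complex u y - complex_of_real x))"
      using y by (intro integrable_cauchy_kernel) simp
    then have "(LINT x|M. y / ((u - x)^2 + y^2)) = - Im (cauchy_transform M (Complex u y))"
      unfolding im cauchy_transform_def by simp
    then show ?thesis
      by (simp only: integral_mult_right_zero integral_complex_of_real)
  qed
  have "char M t * cauchy_char (t * y) = (CLINT x|M. iexp (t * x) * cauchy_char (t * y))"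
    by (simp add: char_def)
  also have "\<dots> = (CLINT x|M. CLINT u|lborel. ?f x u)"
    by (simp only: integral_poisson[OF y])
  also have "\<dots> = (CLINT u|lborel. CLINT x|M. ?f x u)"
    by (rule Fubini_integral[OF int, symmetric])
  finally show ?thesis unfolding inner .
qed

lemma cauchy_transform_eq_imp_eq:
  assumes "real_distribution M" "real_distribution N"
    and eq: "\<And>z. Im z > 0 \<Longrightarrow> cauchy_transform M z = cauchy_transform N z"
  shows "M = N"
proof (rule Levy_uniqueness[OF assms(1,2)], rule ext)
  fix t
  define y where "y n = 1 / real (Suc n)" for n
  have y: "y n > 0" for n by (simp add: y_def)
  have "(\<lambda>n. char M t * cauchy_char (t * y n)) = (\<lambda>n. char N t * cauchy_char (t * y n))"
  proof
    fix n
    show "char M t * cauchy_char (t * y n) = char N t * cauchy_char (t * y n)"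
    using y[of n] by (simp add: real_distribution.char_mult_cauchy_char[OF assms(1)]
        real_distribution.char_mult_cauchy_char[OF assms(2)] eq del: mult_cancel_right)
  qed
  moreover have "(\<lambda>n. t * y n) \<longlonglongrightarrow> 0" unfolding y_def by real_asymp
  note cauchy_char_tendsto[OF this]
  then have "(\<lambda>n. char M t * cauchy_char (t * y n)) \<longlonglongrightarrow> char M t * cauchy_char 0"
    "(\<lambda>n. char N t * cauchy_char (t * y n)) \<longlonglongrightarrow> char N t * cauchy_char 0"
    by (intro tendsto_intros; assumption)+
  ultimately have "char M t * cauchy_char 0 = char N t * cauchy_char 0"
    using LIMSEQ_unique by metis
  then show "char M t = char N t" using cauchy_char_0_nonzero by simp
qed

section \<open>Laplace transform of the Khintchine exponent\<close>

text \<open>The gamma integral, read off from the total mass 1 of the Erlang density.\<close>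

lemma laplace_power:
  fixes t :: real
  assumes t: "t > 0"
  shows "has_bochner_integral lborel (\<lambda>s. indicator {0..} s *\<^sub>R (s^k * exp (- t * s))) (fact k / t^(Suc k))"
proof -
  have "(\<integral>\<^sup>+ x. ennreal (erlang_density k t x) \<partial>lborel) = 1"
    using nn_integral_erlang_ith_moment[OF t, of k 0] by simp
  then have "has_bochner_integral lborel (erlang_density k t) 1"
    using t by (intro has_bochner_integral_nn_integral) auto
  then have "has_bochner_integral lborel (\<lambda>x. (fact k / t^(Suc k)) * erlang_density k t x) (fact k / t^(Suc k) * 1)"
    by (rule has_bochner_integral_mult_right)
  moreover have "(fact k / t^(Suc k)) * erlang_density k t x = indicator {0..} x *\<^sub>R (x^k * exp (- t * x))" for x
    using t by (simp add: erlang_density_def indicator_def)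
  ultimately show ?thesis by simp
qed

lemma laplace_power_complex:
  fixes t :: real
  assumes "t > 0"
  shows "has_bochner_integral lborel (\<lambda>s. indicator {0..} s *\<^sub>R (complex_of_real (s^k * exp (- t * s))))
    (complex_of_real (fact k / t^(Suc k)))"
proof -
  have "has_bochner_integral lborel (\<lambda>s. complex_of_real (indicator {0..} s *\<^sub>R (s^k * exp (- t * s))))
      (complex_of_real (fact k / t^(Suc k)))"
    by (rule has_bochner_integral_of_real[OF laplace_power[OF assms, of k]])
  then show ?thesis by (simp only: scaleR_conv_of_real of_real_mult of_real_eq_id id_apply)
qed

lemma laplace_exp:
  assumes p: "Re p > 0"
  shows "has_bochner_integral lborel (\<lambda>s. indicator {0..} s *\<^sub>R exp (- (p * complex_of_real s))) (1 / p)"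
proof -
  let ?f = "\<lambda>s. exp (- (p * complex_of_real s))"
  have "integrable lborel (\<lambda>s. indicator {0..} s *\<^sub>R ?f s)"
  proof (rule Bochner_Integration.integrable_bound)
    show "integrable lborel (\<lambda>s. indicator {0..} s *\<^sub>R (s^0 * exp (- Re p * s)))"
      using laplace_power[OF p, of 0] has_bochner_integral_iff by blast
  qed (auto simp: indicator_def)
  then have int: "set_integrable lborel {0..} ?f" by (simp add: set_integrable_def)
  have "(CLBINT s:{0..}. ?f s) = 1 / p"
  proof (rule tendsto_unique[OF trivial_limit_at_top_linorder])
    show "((\<lambda>b. CLBINT s:{0..b}. ?f s) \<longlongrightarrow> (CLBINT s:{0..}. ?f s)) at_top"
      by (rule tendsto_set_lebesgue_integral_at_top[OF _ int]) simp
    have "((\<lambda>b. (1 - ?f b) / p) \<longlongrightarrow> (1 - 0) / p) at_top"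
    proof (intro tendsto_intros)
      show "(?f \<longlongrightarrow> 0) at_top"
      proof (rule Lim_null_comparison)
        show "\<forall>\<^sub>F s in at_top. cmod (?f s) \<le> exp (- Re p * s)" by simp
        show "((\<lambda>s. exp (- Re p * s)) \<longlongrightarrow> 0) at_top" using p by real_asymp
      qed
    qed (use p in auto)
    moreover have "\<forall>\<^sub>F b in at_top. (1 - ?f b) / p = (CLBINT s:{0..b}. ?f s)"
      using eventually_ge_at_top[of 0]
    proof eventually_elim
      fix b :: real assume b: "0 \<le> b"
      have "(CLBINT s:{0..b}. ?f s) = - ?f b / p - - ?f 0 / p"
        unfolding set_lebesgue_integral_def
      proof (rule integral_FTC_atLeastAtMost[OF b])
        show "((\<lambda>s. - ?f s / p) has_vector_derivative ?f x) (at x within {0..b})" for x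
        proof (rule has_vector_derivative_real_field[where f = "\<lambda>z. - exp (- (p * z)) / p"])
          show "((\<lambda>z. - exp (- (p * z)) / p) has_field_derivative ?f x) (at (complex_of_real x))"
            using p by (auto intro!: derivative_eq_intros)
        qed
      qed (intro continuous_intros)
      then show "(1 - ?f b) / p = (CLBINT s:{0..b}. ?f s)" by (simp add: diff_divide_distrib)
    qed
    ultimately show "((\<lambda>b. CLBINT s:{0..b}. ?f s) \<longlongrightarrow> 1 / p) at_top"
      by (simp add: tendsto_cong)
  qed
  with int show ?thesis
    by (simp add: has_bochner_integral_iff set_integrable_def set_lebesgue_integral_def)
qed

lemma borel_measurable_khintchine_integrand[measurable]:
  assumes [measurable]: "f \<in> borel_measurable M" "g \<in> borel_measurable M"
  shows "(\<lambda>x. khintchine_integrand (f x) (g x)) \<in> borel_measurable M"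
  unfolding khintchine_integrand_def by measurable

text \<open>Uniform in \<open>x\<close>, so the integrand is integrable for every finite measure;
  polynomial in \<open>s\<close>, so the Laplace integral converges. For small \<open>x\<close> the
  second-order Taylor remainder compensates \<open>1 / x^2\<close>; for large \<open>x\<close> the
  weight is at most 2 and the trivial bound suffices.\<close>

lemma norm_khintchine_integrand_le:
  "cmod (khintchine_integrand s x) \<le> 4 + \<bar>s\<bar> + s^2"
proof -
  have pos: "1 + x^2 > 0" by (simp add: add_pos_nonneg)
  have nrm: "cmod (khintchine_integrand s x) =
      cmod (iexp (s * x) - 1 - \<i> * complex_of_real (s * x / (1 + x^2))) * ((1 + x^2) / x^2)" if "x \<noteq> 0"
    using that pos by (simp add: khintchine_integrand_def norm_mult del: of_real_divide of_real_add of_real_mult)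
  have nn: "(1 + x^2) / x^2 \<ge> 0" by (simp add: add_nonneg_nonneg)
  consider "x = 0" | "x \<noteq> 0" "\<bar>x\<bar> \<le> 1" | "\<bar>x\<bar> > 1" by linarith
  then show ?thesis
  proof cases
    case 1
    then show ?thesis by (simp add: khintchine_integrand_def add_nonneg_nonneg norm_divide norm_power)
  next
    case 2
    \<comment> \<open>The gap between the true linear term and the regularised one. It is of order
      \<open>x^3\<close>, so it survives the weight \<open>(1 + x^2) / x^2\<close>.\<close>
    define r where "r = s * x - s * x / (1 + x^2)"
    have r: "r = s * x^3 / (1 + x^2)"
      using pos by (simp add: r_def field_simps power2_eq_square power3_eq_cube)
    have "iexp (s * x) - 1 - \<i> * complex_of_real (s * x / (1 + x^2))
        = (iexp (s * x) - (1 + \<i> * complex_of_real (s * x))) + \<i> * complex_of_real r"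
      by (simp add: r_def algebra_simps)
    also have "cmod \<dots> \<le> (s * x)^2 / 2 + \<bar>r\<bar>"
      using iexp_approx1[of "s * x" 1] norm_triangle_ineq
      by (intro norm_triangle_le add_mono) (auto simp: norm_mult numeral_2_eq_2)
    finally have "cmod (khintchine_integrand s x) \<le> ((s * x)^2 / 2 + \<bar>r\<bar>) * ((1 + x^2) / x^2)"
      unfolding nrm[OF 2(1)] by (rule mult_right_mono[OF _ nn])
    also have "\<dots> = s^2 * ((1 + x^2) / 2) + \<bar>s\<bar> * \<bar>x\<bar>"
    proof -
      have "\<bar>r\<bar> * ((1 + x^2) / x^2) = \<bar>s\<bar> * \<bar>x\<bar>"
        using 2 pos by (simp add: r abs_mult abs_divide power3_eq_cube power2_eq_square)
      moreover have "(s * x)^2 / 2 * ((1 + x^2) / x^2) = s^2 * ((1 + x^2) / 2)"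
        using 2 by (simp add: power_mult_distrib)
      ultimately show ?thesis by (simp only: distrib_right)
    qed
    also have "\<dots> \<le> s^2 * 1 + \<bar>s\<bar> * 1"
      using 2 by (intro add_mono mult_left_mono) (auto simp: abs_square_le_1)
    finally show ?thesis by simp
  next
    case 3
    then have x0: "x \<noteq> 0" by auto
    from 3 have x2: "x^2 \<ge> 1" using one_le_power[of "\<bar>x\<bar>" 2] by simp
    have "cmod (iexp (s * x) - 1 - \<i> * complex_of_real (s * x / (1 + x^2)))
        \<le> cmod (iexp (s * x)) + cmod 1 + cmod (\<i> * complex_of_real (s * x / (1 + x^2)))"
      by (meson norm_triangle_ineq4 order_trans add_mono order_refl)
    also have "\<dots> = 2 + \<bar>s\<bar> * \<bar>x\<bar> / (1 + x^2)"
      using pos by (simp add: norm_mult abs_mult del: of_real_divide of_real_mult)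
    finally have "cmod (khintchine_integrand s x) \<le> (2 + \<bar>s\<bar> * \<bar>x\<bar> / (1 + x^2)) * ((1 + x^2) / x^2)"
      unfolding nrm[OF x0] by (rule mult_right_mono[OF _ nn])
    also have "\<dots> = 2 * ((1 + x^2) / x^2) + \<bar>s\<bar> * \<bar>x\<bar> / x^2"
    proof -
      have "p / q * (q / r) = p / r" if "q \<noteq> 0" for p q r :: real using that by simp
      from this[of "1 + x^2"] show ?thesis using pos by (simp only: distrib_right)
    qed
    also have "\<dots> \<le> 2 * 2 + \<bar>s\<bar> * 1"
    proof -
      have "\<bar>x\<bar> \<le> x^2" using 3 self_le_power[of "\<bar>x\<bar>" 2] by simp
      then have "\<bar>x\<bar> / x^2 \<le> 1" using x2 by (simp add: divide_le_eq_1)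
      then have "\<bar>s\<bar> * (\<bar>x\<bar> / x^2) \<le> \<bar>s\<bar> * 1" by (intro mult_left_mono) auto
      moreover have "(1 + x^2) / x^2 \<le> 2" using x2 by (subst pos_divide_le_eq) auto
      ultimately show ?thesis
        using times_divide_eq_right[of "\<bar>s\<bar>" "\<bar>x\<bar>" "x^2"] by linarith
    qed
    finally show ?thesis using zero_le_power2[of s] by linarith
  qed
qed

text \<open>Conjugation turns \<open>iexp (s * x)\<close> into \<open>exp (- i s x)\<close>, whose
  Laplace transform is \<open>1 / (t + i x)\<close>; this puts the pole of the kernel at
  \<open>x = i t\<close>. The constant and linear terms contribute \<open>1 / t\<close> and
  \<open>1 / t^2\<close>. At \<open>x = 0\<close> both sides are \<open>- 1 / t^3\<close>.\<close>

lemma laplace_khintchine_integrand: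
  assumes t: "t > 0"
  shows "has_bochner_integral lborel
     (\<lambda>s. indicator {0..} s *\<^sub>R (cnj (khintchine_integrand s x) * complex_of_real (exp (- t * s))))
     (nevanlinna_kernel (\<i> * complex_of_real t) x / (\<i> * complex_of_real (t^2)))"
proof (cases "x = 0")
  case True
  have "has_bochner_integral lborel (\<lambda>s. - (1/2) * (indicator {0..} s *\<^sub>R complex_of_real (s^2 * exp (- t * s))))
     (- (1/2) * complex_of_real (fact 2 / t^Suc 2))"
    by (rule has_bochner_integral_mult_right[OF laplace_power_complex[OF t]])
  moreover have "- (1/2) * complex_of_real (fact 2 / t^Suc 2) = nevanlinna_kernel (\<i> * complex_of_real t) x / (\<i> * complex_of_real (t^2))"
    using t by (simp add: True nevanlinna_kernel_def fact_2 power2_eq_square power3_eq_cube field_simps)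
  moreover have "- (1/2) * (indicator {0..} s *\<^sub>R complex_of_real (s^2 * exp (- t * s)))
     = indicator {0..} s *\<^sub>R (cnj (khintchine_integrand s x) * complex_of_real (exp (- t * s)))" for s
    by (simp add: True khintchine_integrand_def scaleR_conv_of_real)
  ultimately show ?thesis by simp
next
  case False
  define c where "c = complex_of_real ((1 + x^2) / x^2)"
  define b where "b = \<i> * complex_of_real (x / (1 + x^2))"
  define p where "p = complex_of_real t + \<i> * complex_of_real x"
  have p: "Re p > 0" using t by (simp add: p_def)
  have "has_bochner_integral lborel (\<lambda>s. c * (indicator {0..} s *\<^sub>R exp (- (p * complex_of_real s))
         - indicator {0..} s *\<^sub>R complex_of_real (s^0 * exp (- t * s))
         + b * (indicator {0..} s *\<^sub>R complex_of_real (s^1 * exp (- t * s)))))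
      (c * (1 / p - complex_of_real (fact 0 / t^Suc 0) + b * complex_of_real (fact 1 / t^Suc 1)))"
    by (intro has_bochner_integral_mult_right has_bochner_integral_add has_bochner_integral_diff
          laplace_exp[OF p] laplace_power_complex[OF t])
  moreover have "c * (indicator {0..} s *\<^sub>R exp (- (p * complex_of_real s))
         - indicator {0..} s *\<^sub>R complex_of_real (s^0 * exp (- t * s))
         + b * (indicator {0..} s *\<^sub>R complex_of_real (s^1 * exp (- t * s))))
     = indicator {0..} s *\<^sub>R (cnj (khintchine_integrand s x) * complex_of_real (exp (- t * s)))" for s
  proof -
    have 1: "exp (- (p * complex_of_real s)) = cnj (iexp (s * x)) * complex_of_real (exp (- t * s))"
      unfolding exp_cnj exp_of_real[symmetric] exp_add[symmetric] by (simp add: p_def algebra_simps)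
    have 2: "cnj (khintchine_integrand s x) = (cnj (iexp (s * x)) - 1 + b * complex_of_real s) * c"
      using False by (simp add: khintchine_integrand_def b_def c_def)
    show ?thesis unfolding 1 2 by (simp add: scaleR_conv_of_real algebra_simps)
  qed
  moreover have "c * (1 / p - complex_of_real (fact 0 / t^Suc 0) + b * complex_of_real (fact 1 / t^Suc 1))
      = nevanlinna_kernel (\<i> * complex_of_real t) x / (\<i> * complex_of_real (t^2))"
  proof -
    define T X where "T = complex_of_real t" and "X = complex_of_real x"
    have nz: "T \<noteq> 0" "X \<noteq> 0" using t False by (auto simp: T_def X_def)
    have x1: "1 + x^2 \<noteq> 0" by (metis add_pos_nonneg less_irrefl zero_le_power2 zero_less_one)
    then have n1: "1 + X^2 \<noteq> 0" unfolding X_def by (metis of_real_1 of_real_add of_real_eq_0_iff of_real_power)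
    have np: "T + \<i> * X \<noteq> 0" using t by (auto simp: T_def X_def complex_eq_iff)
    have "(\<i> * T - X) * (\<i> * T^2) = - ((T + \<i> * X) * T^2)" by (simp add: algebra_simps)
    then have k: "nevanlinna_kernel (\<i> * T) x / (\<i> * T^2) = - ((1 + \<i> * T * X) / ((T + \<i> * X) * T^2))"
      by (simp add: nevanlinna_kernel_def X_def[symmetric] divide_divide_eq_left)
    have "c * (1 / p - 1 / T + b / T^2) = (1 + X^2) / X^2 * (1 / (T + \<i> * X) - 1 / T) + \<i> * (1 / (X * T^2))"
    proof -
      have "(1 + x^2) / x^2 * (x / (1 + x^2)) = 1 / x"
        using x1 False by (simp add: power2_eq_square)
      then have "c * b = \<i> * (1 / X)"
        unfolding b_def c_def X_def by (metis mult.left_commute of_real_1 of_real_divide of_real_mult)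
      then have cb: "c * (b / T^2) = \<i> * (1 / (X * T^2))" by simp
      have "c = (1 + X^2) / X^2" by (simp add: c_def X_def)
      moreover have "c * (1 / p - 1 / T + b / T^2) = c * (1 / p - 1 / T) + c * (b / T^2)"
        by (rule distrib_left)
      ultimately show ?thesis unfolding cb by (simp only: p_def T_def X_def)
    qed
    also have "1 / (T + \<i> * X) - 1 / T = - \<i> * X / ((T + \<i> * X) * T)"
      using np nz by (simp add: field_simps)
    also have "(1 + X^2) / X^2 * (- \<i> * X / ((T + \<i> * X) * T)) + \<i> * (1 / (X * T^2))
        = - \<i> * ((1 + X^2) * T - (T + \<i> * X)) / (X * (T + \<i> * X) * T^2)"
    proof -
      have "(1 + X^2) / X^2 * (- \<i> * X / (D * T)) + \<i> * (1 / (X * T^2))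
          = - \<i> * ((1 + X^2) * T - D) / (X * D * T^2)" if "D \<noteq> 0" for D
        using that nz by (simp add: field_simps power2_eq_square)
      from this[OF np] show ?thesis .
    qed
    also have "- \<i> * ((1 + X^2) * T - (T + \<i> * X)) = - (X * (1 + \<i> * T * X))"
      by (simp add: power2_eq_square algebra_simps)
    also have "- (X * (1 + \<i> * T * X)) / (X * (T + \<i> * X) * T^2) = - ((1 + \<i> * T * X) / ((T + \<i> * X) * T^2))"
      using nz by (simp add: mult.assoc)
    finally show ?thesis unfolding k[symmetric] by (simp add: T_def power2_eq_square)
  qed
  ultimately show ?thesis by simp
qed

context finite_borel_measure
begin

lemma integrable_khintchine_integrand: "integrable M (khintchine_integrand s)"
  by (rule integrable_const_bound[of _ "4 + \<bar>s\<bar> + s^2"]) (auto simp: norm_khintchine_integrand_le)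

text \<open>Fubini reduces the claim to the pointwise Laplace transform. The drift has conjugate
  \<open>- i s a\<close>, with transform \<open>- i a / t^2\<close>, which the prefactor
  \<open>i t^2\<close> turns back into \<open>a\<close>.\<close>

lemma laplace_khintchine_exponent:
  assumes t: "t > 0"
  shows "\<i> * complex_of_real (t^2) *
      (CLBINT s:{0..}. cnj (khintchine_exponent a M s) * complex_of_real (exp (- t * s)))
    = complex_of_real a + (CLINT x|M. nevanlinna_kernel (\<i> * complex_of_real t) x)"
proof -
  let ?f = "\<lambda>x s. indicator {0..} s *\<^sub>R (cnj (khintchine_integrand s x) * complex_of_real (exp (- t * s)))"
  let ?g = "\<lambda>s. indicator {0..} s *\<^sub>R complex_of_real (s^1 * exp (- t * s))"
  \<comment> \<open>The polynomial bound on the integrand times the exponential: a majorant free of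
    \<open>x\<close>, hence integrable over the product with a finite measure.\<close>
  define g where "g s = 4 * (indicator {0..} s *\<^sub>R (s^0 * exp (- t * s)))
      + indicator {0..} s *\<^sub>R (s^1 * exp (- t * s)) + indicator {0..} s *\<^sub>R (s^2 * exp (- t * s))" for s :: real
  have int_g: "integrable lborel g"
    unfolding g_def by (intro Bochner_Integration.integrable_add integrable_mult_right
        has_bochner_integral_iff[THEN iffD1, OF laplace_power[OF t], THEN conjunct1])
  have f_le: "cmod (?f x s) \<le> g s" for x s
  proof (cases "s \<ge> 0")
    case True
    have "cmod (?f x s) = cmod (khintchine_integrand s x) * exp (- t * s)"
      using True by (simp add: norm_mult)
    also have "\<dots> \<le> (4 + \<bar>s\<bar> + s^2) * exp (- t * s)"
      by (intro mult_right_mono norm_khintchine_integrand_le) simp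
    also have "\<dots> = g s" using True by (simp add: g_def algebra_simps)
    finally show ?thesis .
  qed (simp add: g_def)
  interpret pair_sigma_finite M lborel ..
  have [measurable]: "cnj \<in> borel_measurable borel"
    by (intro borel_measurable_continuous_onI continuous_intros)
  have meas[measurable]: "case_prod ?f \<in> borel_measurable (M \<Otimes>\<^sub>M lborel)"
    by measurable
  have int: "integrable (M \<Otimes>\<^sub>M lborel) (case_prod ?f)"
  proof (rule Fubini_integrable[OF meas])
    have bnd: "(LINT s|lborel. cmod (case_prod ?f (x, s))) \<le> (LINT s|lborel. g s)" for x
    proof (rule integral_mono[OF _ int_g])
      show "integrable lborel (\<lambda>s. cmod (case_prod ?f (x, s)))"
        using integrable_norm[OF has_bochner_integral_iff[THEN iffD1, OF laplace_khintchine_integrand[OF t, of x], THEN conjunct1]]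
        by simp
    qed (use f_le in simp)
    show "integrable M (\<lambda>x. LINT s|lborel. cmod (case_prod ?f (x, s)))"
    proof (rule integrable_const_bound[of _ "LINT s|lborel. g s"])
      show "AE x in M. norm (LINT s|lborel. cmod (case_prod ?f (x, s))) \<le> (LINT s|lborel. g s)"
        using bnd by (simp add: Bochner_Integration.integral_nonneg)
    qed measurable
    show "AE x in M. integrable lborel (\<lambda>s. case_prod ?f (x, s))"
      using laplace_khintchine_integrand[OF t] by (auto simp: has_bochner_integral_iff)
  qed
  have inner: "(CLINT x|M. ?f x s) = indicator {0..} s *\<^sub>R (cnj (CLINT x|M. khintchine_integrand s x) * complex_of_real (exp (- t * s)))" for s
    by simp
  have "integrable lborel (\<lambda>s. CLINT x|M. ?f x s)"
    using integrable_snd[OF int] by simp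
  moreover have int_a: "has_bochner_integral lborel (\<lambda>s. - \<i> * a * ?g s) (- \<i> * a * complex_of_real (fact 1 / t^Suc 1))"
    by (rule has_bochner_integral_mult_right[OF laplace_power_complex[OF t]])
  moreover have "indicator {0..} s *\<^sub>R (cnj (khintchine_exponent a M s) * complex_of_real (exp (- t * s)))
      = - \<i> * a * ?g s + (CLINT x|M. ?f x s)" for s
    unfolding inner khintchine_exponent_def by (simp add: scaleR_conv_of_real algebra_simps)
  ultimately have "(CLBINT s:{0..}. cnj (khintchine_exponent a M s) * complex_of_real (exp (- t * s)))
      = - \<i> * a * complex_of_real (fact 1 / t^Suc 1) + (CLINT s|lborel. CLINT x|M. ?f x s)"
    unfolding set_lebesgue_integral_def by (simp only: Bochner_Integration.integral_add has_bochner_integral_iff)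
  also have "(CLINT s|lborel. CLINT x|M. ?f x s) = (CLINT x|M. CLINT s|lborel. ?f x s)"
    by (rule Fubini_integral[OF int])
  also have "\<dots> = (CLINT x|M. nevanlinna_kernel (\<i> * complex_of_real t) x / (\<i> * complex_of_real (t^2)))"
    using laplace_khintchine_integrand[OF t] by (simp only: has_bochner_integral_iff)
  also have "\<dots> = (CLINT x|M. nevanlinna_kernel (\<i> * complex_of_real t) x) / (\<i> * complex_of_real (t^2))"
    by (rule integral_divide_zero)
  also have "- \<i> * a * complex_of_real (fact 1 / t^Suc 1) = - (\<i> * a / complex_of_real (t^2))"
    by (simp add: power2_eq_square)
  finally have "(CLBINT s:{0..}. cnj (khintchine_exponent a M s) * complex_of_real (exp (- t * s)))
      = - (\<i> * a / complex_of_real (t^2)) + (CLINT x|M. nevanlinna_kernel (\<i> * complex_of_real t) x) / (\<i> * complex_of_real (t^2))" .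
  moreover have "\<i> * T * (- (\<i> * A / T) + K / (\<i> * T)) = A + K" if "T \<noteq> 0" for A K T :: complex
    using that by (simp add: field_simps)
  moreover have "complex_of_real (t^2) \<noteq> 0" using t by simp
  ultimately show ?thesis by (simp only:)
qed

section \<open>Symmetric Khintchine pairs\<close>

lemma symmetric_integral_odd:
  fixes f :: "real \<Rightarrow> real"
  assumes sym: "symmetric_measure M" and f: "f \<in> borel_measurable borel" and odd: "\<And>x. f (- x) = - f x"
  shows "(LINT x|M. f x) = 0"
proof -
  have "(LINT x|M. f x) = (LINT x|distr M borel uminus. f x)"
    using sym by (simp add: symmetric_measure_def)
  also have "\<dots> = (LINT x|M. f (- x))" by (subst integral_distr) (use f in auto)
  also have "\<dots> = - (LINT x|M. f x)" by (simp add: odd)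
  finally show ?thesis by simp
qed

text \<open>The imaginary part of the integrand is odd in \<open>x\<close> and integrates to 0, so
  the exponent is real and the conjugation in the Laplace formula has no effect.\<close>

lemma symmetric_khintchine_exponent:
  assumes sym: "symmetric_measure M"
  shows "khintchine_exponent 0 M s = complex_of_real (LINT x|M. cos_integrand s x)"
proof -
  have "Im (khintchine_exponent 0 M s) = (LINT x|M. Im (khintchine_integrand s x))"
    using integrable_khintchine_integrand by (simp add: khintchine_exponent_def)
  also have "\<dots> = 0"
  proof (rule symmetric_integral_odd[OF sym])
    show "(\<lambda>x. Im (khintchine_integrand s x)) \<in> borel_measurable borel" by measurable
    show "Im (khintchine_integrand s (- x)) = - Im (khintchine_integrand s x)" for x
      by (simp add: khintchine_integrand_def Im_exp algebra_simps add_divide_distrib diff_divide_distrib)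
  qed
  finally have "Im (khintchine_exponent 0 M s) = 0" .
  moreover have "Re (khintchine_exponent 0 M s) = (LINT x|M. Re (khintchine_integrand s x))"
    using integrable_khintchine_integrand by (simp add: khintchine_exponent_def)
  moreover have "Re (khintchine_integrand s x) = cos_integrand s x" for x
    by (simp add: khintchine_integrand_def cos_integrand_def Re_exp)
  ultimately show ?thesis by (simp add: complex_eq_iff)
qed

lemma symmetric_laplace_exponent:
  assumes sym: "symmetric_measure M"
  shows "\<i> * complex_of_real (t^2) *
      (CLBINT s:{0..}. cnj (khintchine_exponent 0 M s) * complex_of_real (exp (- t * s)))
    = \<i> * complex_of_real t * complex_of_real (LBINT s:{0..}. (LINT x|M. cos_integrand s x) * t * exp (- s * t))"
proof -
  have "(CLBINT s:{0..}. cnj (khintchine_exponent 0 M s) * complex_of_real (exp (- t * s)))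
      = complex_of_real (LBINT s:{0..}. (LINT x|M. cos_integrand s x) * exp (- t * s))"
    unfolding symmetric_khintchine_exponent[OF sym] complex_cnj_complex_of_real of_real_mult[symmetric]
    by (rule set_integral_complex_of_real)
  moreover have "(LBINT s:{0..}. (LINT x|M. cos_integrand s x) * t * exp (- s * t))
      = t * (LBINT s:{0..}. (LINT x|M. cos_integrand s x) * exp (- t * s))"
    unfolding set_integral_mult_right[symmetric] by (simp add: mult_ac)
  ultimately show ?thesis by (simp add: power2_eq_square)
qed

lemma symmetric_nevanlinna_integral:
  assumes sym: "symmetric_measure M" and t: "t > 0"
  shows "(CLINT x|M. nevanlinna_kernel (\<i> * complex_of_real t) x)
    = - \<i> * complex_of_real t * complex_of_real (LINT x|M. (1 + x^2) / (t^2 + x^2))"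
proof -
  let ?z = "\<i> * complex_of_real t"
  have int: "integrable M (nevanlinna_kernel ?z)"
    using t by (intro integrable_nevanlinna_kernel) simp
  have nrm: "(cmod (?z - complex_of_real x))^2 = t^2 + x^2" for x
    by (simp add: cmod_power2)
  have "Re (CLINT x|M. nevanlinna_kernel ?z x) = (LINT x|M. Re (nevanlinna_kernel ?z x))"
    using int by simp
  also have "\<dots> = 0"
  proof (rule symmetric_integral_odd[OF sym])
    show "(\<lambda>x. Re (nevanlinna_kernel ?z x)) \<in> borel_measurable borel"
      unfolding nevanlinna_kernel_def by measurable
    show "Re (nevanlinna_kernel ?z (- x)) = - Re (nevanlinna_kernel ?z x)" for x
      by (simp add: nevanlinna_kernel_def Re_divide minus_divide_left)
  qed
  finally have "Re (CLINT x|M. nevanlinna_kernel ?z x) = 0" .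
  moreover have "Im (CLINT x|M. nevanlinna_kernel ?z x) = (LINT x|M. Im (nevanlinna_kernel ?z x))"
    using int by simp
  moreover have "\<dots> = - t * (LINT x|M. (1 + x^2) / (t^2 + x^2))"
    using t by (simp add: Im_nevanlinna_kernel nrm flip: integral_mult_right_zero)
  ultimately show ?thesis by (simp add: complex_eq_iff)
qed

end

section \<open>Voiculescu transforms\<close>

lemma trunc_cone_subset: "\<beta> \<ge> 0 \<Longrightarrow> trunc_cone \<alpha> \<beta> \<subseteq> upper_half_plane"
  by (auto simp: trunc_cone_def)

lemma open_trunc_cone: "open (trunc_cone \<alpha> \<beta>)"
  unfolding trunc_cone_def by (intro open_Collect_conj open_Collect_less continuous_intros)

lemma trunc_cone_mono: "\<beta> \<ge> 0 \<Longrightarrow> \<alpha> \<le> \<alpha>' \<Longrightarrow> \<beta>' \<le> \<beta> \<Longrightarrow> trunc_cone \<alpha> \<beta> \<subseteq> trunc_cone \<alpha>' \<beta>'"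
  by (auto simp: trunc_cone_def intro: less_le_trans mult_right_mono)

lemma voiculescu_on_subset: "voiculescu_on \<nu> \<phi> S \<Longrightarrow> T \<subseteq> S \<Longrightarrow> voiculescu_on \<nu> \<phi> T"
  unfolding voiculescu_on_def by blast

lemma voiculescu_values_cong:
  "(\<And>t. t > 0 \<Longrightarrow> h t = h' t) \<Longrightarrow>
    voiculescu_values_on_imag_axis \<nu> h \<Longrightarrow> voiculescu_values_on_imag_axis \<nu> h'"
  unfolding voiculescu_values_on_imag_axis_def by (metis (no_types, lifting))

context nevanlinna_data
begin

text \<open>The F-transform of the constructed measure is \<open>F\<close>, which is injective
  because \<open>H\<close> is its left inverse. \<open>H_cone\<close> supplies the cone in the
  definition of \<open>voiculescu_on\<close>, since \<open>z + V z\<close> is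
  \<open>H z\<close>.\<close>

lemma exists_measure_voiculescu:
  obtains \<nu> \<beta> where "real_distribution \<nu>" "\<beta> \<ge> 1" "voiculescu_on \<nu> V (trunc_cone 1 \<beta>)"
proof -
  obtain F where F: "F holomorphic_on upper_half_plane"
    "\<And>z. z \<in> \<Omega> \<Longrightarrow> F (H z) = z" "\<And>z. Im z > 0 \<Longrightarrow> F z \<in> \<Omega>" "\<And>z. Im z > 0 \<Longrightarrow> H (F z) = z"
    "((\<lambda>y. \<i> * complex_of_real y / F (\<i> * complex_of_real y)) \<longlongrightarrow> 1) at_top"
    by (rule obtain_inverse_H) blast
  have ImF: "Im (F z) > 0" if "Im z > 0" for z using F(3)[OF that] by (simp add: \<Omega>_def)
  have F0: "F z \<noteq> 0" if "Im z > 0" for z using ImF[OF that] by auto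
  obtain \<nu> where \<nu>: "real_distribution \<nu>" "\<And>z. Im z > 0 \<Longrightarrow> 1 / F z = cauchy_transform \<nu> z"
  proof (rule cauchy_transform_representation[of "\<lambda>z. 1 / F z"])
    show "(\<lambda>z. 1 / F z) holomorphic_on upper_half_plane"
      using F0 by (intro holomorphic_intros F(1)) auto
    show "Im (1 / F z) < 0" if "Im z > 0" for z
      using ImF[OF that] F0[OF that] by (simp add: Im_divide divide_less_0_iff complex_neq_0)
    show "((\<lambda>y. \<i> * complex_of_real y * (1 / F (\<i> * complex_of_real y))) \<longlongrightarrow> 1) at_top"
      using F(5) by simp
  qed blast
  have FT: "F_transform \<nu> z = F z" if "Im z > 0" for z
    using \<nu>(2)[OF that] by (simp add: F_transform_def flip: \<nu>(2)[OF that])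
  obtain \<beta> where \<beta>: "\<beta> \<ge> 1" "trunc_cone 1 \<beta> \<subseteq> \<Omega>" "H ` trunc_cone 1 \<beta> \<subseteq> trunc_cone 3 (1 / 2)"
    by (rule H_cone)
  have cone: "Im z > 0" if "z \<in> trunc_cone 3 (1 / 2)" for z using that by (simp add: trunc_cone_def)
  have "inj_on (F_transform \<nu>) (trunc_cone 3 (1 / 2))"
    by (rule inj_onI) (metis FT F(4) cone)
  moreover have "z + V z \<in> trunc_cone 3 (1 / 2) \<and> F_transform \<nu> (z + V z) = z" if z: "z \<in> trunc_cone 1 \<beta>" for z
  proof -
    have "H z \<in> trunc_cone 3 (1 / 2)" using z \<beta>(3) by blast
    moreover have "F_transform \<nu> (H z) = z"
      using FT[OF cone[OF calculation]] F(2) z \<beta>(2) by auto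
    ultimately show ?thesis by (simp add: H_def)
  qed
  ultimately have "voiculescu_on \<nu> V (trunc_cone 1 \<beta>)"
    unfolding voiculescu_on_def by (intro exI[of _ 3] exI[of _ "1 / 2"]) auto
  then show ?thesis using \<nu>(1) \<beta>(1) that by blast
qed

text \<open>\<open>V\<close> is linear in the pair; with \<open>c = 1 / n\<close> the scaled pair
  yields the transform of an \<open>n\<close>-th free convolution root.\<close>

lemma scaled_nevanlinna_data:
  assumes c: "c > 0"
  defines "m' \<equiv> density m (\<lambda>_. ennreal c)"
  shows "nevanlinna_data m'" and "nevanlinna_data.V m' (c * a) z = c * V z"
proof -
  have "emeasure m' (space m') = ennreal c * emeasure m (space m)"
    unfolding m'_def by (simp add: emeasure_density_const)
  then have fin: "finite_measure m'"
    using emeasure_finite by (intro finite_measureI) (simp add: ennreal_mult_eq_top_iff)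
  then show *: "nevanlinna_data m'"
    by (simp add: nevanlinna_data_def finite_borel_measure_def finite_borel_measure_axioms_def m'_def M_is_borel)
  have "(CLINT x|m'. nevanlinna_kernel z x) = (CLINT x|m. c *\<^sub>R nevanlinna_kernel z x)"
    unfolding m'_def using c
    by (intro integral_density) (auto simp: nevanlinna_kernel_def)
  then show "nevanlinna_data.V m' (c * a) z = c * V z"
    unfolding nevanlinna_data.V_def[OF *] V_def by (simp add: scaleR_conv_of_real algebra_simps)
qed

lemma exists_free_inf_div:
  obtains \<nu> \<beta> where "free_inf_div \<nu>" "\<beta> \<ge> 1" "voiculescu_on \<nu> V (trunc_cone 1 \<beta>)"
proof -
  obtain \<nu> \<beta> where \<nu>: "real_distribution \<nu>" "\<beta> \<ge> 1" "voiculescu_on \<nu> V (trunc_cone 1 \<beta>)"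
    by (rule exists_measure_voiculescu)
  have "\<exists>\<nu>n \<phi> \<phi>n \<alpha> \<beta>. prob_space \<nu>n \<and> sets \<nu>n = sets borel \<and> \<alpha> > 0 \<and> \<beta> > 0 \<and>
           voiculescu_on \<nu> \<phi> (trunc_cone \<alpha> \<beta>) \<and> voiculescu_on \<nu>n \<phi>n (trunc_cone \<alpha> \<beta>) \<and>
           (\<forall>z\<in>trunc_cone \<alpha> \<beta>. \<phi> z = of_nat n * \<phi>n z)" if n: "n \<ge> 1" for n :: nat
  proof -
    define c where "c = 1 / real n"
    have c: "c > 0" using n by (simp add: c_def)
    interpret N: nevanlinna_data "density m (\<lambda>_. ennreal c)" "c * a"
      by (rule scaled_nevanlinna_data[OF c])
    obtain \<nu>n \<beta>n where \<nu>n: "real_distribution \<nu>n" "\<beta>n \<ge> 1" "voiculescu_on \<nu>n N.V (trunc_cone 1 \<beta>n)"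
      by (rule N.exists_measure_voiculescu)
    interpret \<nu>n: real_distribution \<nu>n by (rule \<nu>n)
    \<comment> \<open>The two transforms live on cones of different heights; the larger height gives
      the common cone that \<open>free_inf_div\<close> asks for.\<close>
    let ?S = "trunc_cone 1 (max \<beta> \<beta>n)"
    have "voiculescu_on \<nu> V ?S" "voiculescu_on \<nu>n N.V ?S"
      using \<nu>(2) \<nu>n(2) voiculescu_on_subset[OF \<nu>(3)] voiculescu_on_subset[OF \<nu>n(3)] trunc_cone_mono
      by (meson max.cobounded1 max.cobounded2 order_refl order_trans zero_le_one)+
    moreover have "V z = of_nat n * N.V z" for z
    proof -
      have "N.V z = complex_of_real c * V z" by (rule scaled_nevanlinna_data(2)[OF c])
      moreover have "of_nat n * (complex_of_real c * v) = v" for v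
        using n by (simp add: c_def)
      ultimately show ?thesis by metis
    qed
    ultimately show ?thesis
      using \<nu>n.prob_space_axioms \<nu>n.events_eq_borel \<nu>(2)
      by (intro exI[of _ \<nu>n] exI[of _ V] exI[of _ N.V] exI[of _ 1] exI[of _ "max \<beta> \<beta>n"]) auto
  qed
  then have "free_inf_div \<nu>"
    using \<nu>(1) unfolding free_inf_div_def real_distribution_def real_distribution_axioms_def by blast
  then show ?thesis using \<nu>(2,3) that by blast
qed

end

section \<open>Uniqueness from the values on the imaginary axis\<close>

lemma holomorphic_eq_on_imag_axis:
  assumes hol: "\<phi> holomorphic_on upper_half_plane" "\<psi> holomorphic_on upper_half_plane"
    and eq: "\<And>t. t > 0 \<Longrightarrow> \<phi> (\<i> * complex_of_real t) = \<psi> (\<i> * complex_of_real t)"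
    and z: "Im z > 0"
  shows "\<phi> z = \<psi> z"
proof -
  let ?U = "(\<lambda>t. \<i> * complex_of_real t) ` {0<..}"
  have "\<phi> z - \<psi> z = 0"
  proof (rule analytic_continuation[where \<xi> = \<i> and U = ?U and S = upper_half_plane and f = "\<lambda>z. \<phi> z - \<psi> z"])
    show "\<i> islimpt ?U"
      unfolding islimpt_sequential
    proof (intro exI conjI allI)
      show "\<i> * complex_of_real (1 + 1 / real (Suc n)) \<in> ?U - {\<i>}" for n
        by (auto simp: complex_eq_iff add_pos_pos intro!: imageI)
      have "(\<lambda>n. 1 + 1 / real (Suc n)) \<longlonglongrightarrow> 1" by real_asymp
      then have "(\<lambda>n. \<i> * complex_of_real (1 + 1 / real (Suc n))) \<longlonglongrightarrow> \<i> * complex_of_real 1"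
        by (intro tendsto_intros)
      then show "(\<lambda>n. \<i> * complex_of_real (1 + 1 / real (Suc n))) \<longlonglongrightarrow> \<i>" by simp
    qed
    show "(\<lambda>z. \<phi> z - \<psi> z) holomorphic_on upper_half_plane" by (intro holomorphic_intros hol)
  qed (use z eq in \<open>auto simp: open_upper_half_plane connected_upper_half_plane\<close>)
  then show ?thesis by simp
qed

text \<open>The two continuations agree, so \<open>w z = z + \<phi> z\<close> is a common right
  inverse of both F-transforms on a small cone. It is injective, having a left inverse, so its image
  is open; the Cauchy transforms agree there and hence on the whole upper half-plane.\<close>

lemma voiculescu_values_unique:
  assumes \<mu>: "real_distribution \<mu>" "voiculescu_values_on_imag_axis \<mu> h"
    and \<nu>: "real_distribution \<nu>" "voiculescu_values_on_imag_axis \<nu> h"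
  shows "\<mu> = \<nu>"
proof -
  interpret \<mu>: real_distribution \<mu> by (rule \<mu>)
  interpret \<nu>: real_distribution \<nu> by (rule \<nu>)
  obtain \<phi> \<alpha>1 \<beta>1 where \<phi>: "\<phi> holomorphic_on upper_half_plane" "\<alpha>1 > 0" "\<beta>1 > 0"
    "voiculescu_on \<mu> \<phi> (trunc_cone \<alpha>1 \<beta>1)" "\<And>t. t > 0 \<Longrightarrow> \<phi> (\<i> * complex_of_real t) = h t"
    using \<mu>(2) unfolding voiculescu_values_on_imag_axis_def by blast
  obtain \<psi> \<alpha>2 \<beta>2 where \<psi>: "\<psi> holomorphic_on upper_half_plane" "\<alpha>2 > 0" "\<beta>2 > 0"
    "voiculescu_on \<nu> \<psi> (trunc_cone \<alpha>2 \<beta>2)" "\<And>t. t > 0 \<Longrightarrow> \<psi> (\<i> * complex_of_real t) = h t"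
    using \<nu>(2) unfolding voiculescu_values_on_imag_axis_def by blast
  have eq: "\<phi> z = \<psi> z" if "Im z > 0" for z
    using holomorphic_eq_on_imag_axis[OF \<phi>(1) \<psi>(1) _ that] \<phi>(5) \<psi>(5) by simp
  define \<alpha> \<beta> where "\<alpha> = min \<alpha>1 \<alpha>2" and "\<beta> = max \<beta>1 \<beta>2"
  let ?S = "trunc_cone \<alpha> \<beta>"
  have \<alpha>\<beta>: "\<alpha> > 0" "\<beta> > 0" using \<phi> \<psi> by (auto simp: \<alpha>_def \<beta>_def)
  have S: "?S \<subseteq> upper_half_plane" "?S \<subseteq> trunc_cone \<alpha>1 \<beta>1" "?S \<subseteq> trunc_cone \<alpha>2 \<beta>2"
    using \<alpha>\<beta> trunc_cone_subset[of \<beta> \<alpha>] trunc_cone_mono[of \<beta> \<alpha> \<alpha>1 \<beta>1] trunc_cone_mono[of \<beta> \<alpha> \<alpha>2 \<beta>2]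
    by (simp_all add: \<alpha>_def \<beta>_def)
  define w where "w z = z + \<phi> z" for z
  have w\<mu>: "Im (w z) > 0 \<and> F_transform \<mu> (w z) = z" if "z \<in> ?S" for z
    using \<phi>(4) S(2) that unfolding voiculescu_on_def w_def trunc_cone_def by fastforce
  have w\<nu>: "F_transform \<nu> (w z) = z" if "z \<in> ?S" for z
    using \<psi>(4) S(1,3) that eq unfolding voiculescu_on_def w_def by fastforce
  have inj: "inj_on w ?S" using w\<mu> by (metis inj_onI)
  have "w holomorphic_on ?S"
    unfolding w_def by (intro holomorphic_intros holomorphic_on_subset[OF \<phi>(1) S(1)])
  then have "open (w ` ?S)" by (rule open_mapping_thm3[OF _ open_trunc_cone inj])
  moreover have "w ` ?S \<noteq> {}"
  proof -
    have "\<i> * complex_of_real (\<beta> + 1) \<in> ?S" using \<alpha>\<beta> by (simp add: trunc_cone_def)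
    then show ?thesis by blast
  qed
  moreover have "cauchy_transform \<mu> u = cauchy_transform \<nu> u" if "u \<in> w ` ?S" for u
  proof -
    obtain z where z: "z \<in> ?S" "u = w z" using \<open>u \<in> w ` ?S\<close> by blast
    then have "1 / cauchy_transform \<mu> u = 1 / cauchy_transform \<nu> u"
      using w\<mu> w\<nu> by (simp add: F_transform_def)
    \<comment> \<open>Reciprocals may be cancelled even where a Cauchy transform vanishes, since
      \<open>1 / (1 / c) = c\<close> also holds for \<open>c = 0\<close>.\<close>
    then show ?thesis by (metis divide_divide_eq_right div_by_1 mult_1)
  qed
  moreover have "w ` ?S \<subseteq> upper_half_plane" using w\<mu> by auto
  ultimately have "cauchy_transform \<mu> z = cauchy_transform \<nu> z" if "Im z > 0" for z
    using analytic_continuation_open[OF _ open_upper_half_plane _ connected_upper_half_plane _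
        \<mu>.holomorphic_cauchy_transform \<nu>.holomorphic_cauchy_transform, of "w ` ?S" z] that by simp
  then show ?thesis by (rule cauchy_transform_eq_imp_eq[OF \<mu>(1) \<nu>(1)])
qed

theorem theorem1:
  fixes \<mu> m :: "real measure" and a :: real
  assumes kh: "khintchine_pair \<mu> a m"
  defines "h \<equiv> \<lambda>t::real. \<i> * complex_of_real (t^2) *
             (CLBINT s:{0..}. cnj (khintchine_exponent a m s) * complex_of_real (exp (- t * s)))"
  shows "(\<exists>!\<nu>. free_inf_div \<nu> \<and> voiculescu_values_on_imag_axis \<nu> h)
       \<and> (\<forall>t>0. h t = complex_of_real a +
              (CLINT x|m. (1 + \<i> * complex_of_real (t * x)) / (\<i> * complex_of_real t - complex_of_real x)))
       \<and> ((a = 0 \<and> symmetric_measure m) \<longrightarrow>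
           (\<forall>\<nu>. free_inf_div \<nu> \<and> voiculescu_values_on_imag_axis \<nu> h \<longrightarrow>
              voiculescu_values_on_imag_axis \<nu>
                (\<lambda>t. \<i> * complex_of_real t *
                   complex_of_real (LBINT s:{0..}. (LINT x|m. cos_integrand s x) * t * exp (- s * t)))
            \<and> voiculescu_values_on_imag_axis \<nu>
                (\<lambda>t. - \<i> * complex_of_real t *
                   complex_of_real (LINT x|m. (1 + x^2) / (t^2 + x^2)))))"
proof -
  interpret nevanlinna_data m a
    using kh by (auto simp: khintchine_pair_def nevanlinna_data_def finite_borel_measure_def
        finite_borel_measure_axioms_def)
  \<comment> \<open>This identity links the Laplace side with the measure built from
    \<open>V\<close>; existence, formula (Z) and the symmetric formulas all go through it or through
    the definition of \<open>h\<close>.\<close>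
  have h: "h t = V (\<i> * complex_of_real t)" if "t > 0" for t
    unfolding h_def V_def by (rule laplace_khintchine_exponent[OF that])
  then have h': "h t = complex_of_real a + (CLINT x|m. nevanlinna_kernel (\<i> * complex_of_real t) x)" if "t > 0" for t
    using that by (simp add: V_def)
  show ?thesis
  proof (intro conjI allI impI)
    obtain \<nu> \<beta> where \<nu>: "free_inf_div \<nu>" "\<beta> \<ge> 1" "voiculescu_on \<nu> V (trunc_cone 1 \<beta>)"
      by (rule exists_free_inf_div)
    have "\<exists>\<alpha> \<beta>. \<alpha> > 0 \<and> \<beta> > 0 \<and> voiculescu_on \<nu> V (trunc_cone \<alpha> \<beta>)"
      using \<nu>(2,3) by (intro exI[of _ 1] exI[of _ \<beta>]) auto
    then have "voiculescu_values_on_imag_axis \<nu> h"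
      unfolding voiculescu_values_on_imag_axis_def using holomorphic_V h by auto
    moreover have "real_distribution \<nu>'" if "free_inf_div \<nu>'" for \<nu>'
      using that by (auto simp: free_inf_div_def real_distribution_def real_distribution_axioms_def)
    ultimately show "\<exists>!\<nu>. free_inf_div \<nu> \<and> voiculescu_values_on_imag_axis \<nu> h"
      using \<nu>(1) voiculescu_values_unique by blast
  next
    fix t :: real assume "t > 0"
    then show "h t = complex_of_real a +
        (CLINT x|m. (1 + \<i> * complex_of_real (t * x)) / (\<i> * complex_of_real t - complex_of_real x))"
      by (simp add: h V_def nevanlinna_kernel_def mult.assoc)
  next
    fix \<nu> assume sym: "a = 0 \<and> symmetric_measure m"
      and \<nu>: "free_inf_div \<nu> \<and> voiculescu_values_on_imag_axis \<nu> h"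
    show "voiculescu_values_on_imag_axis \<nu> (\<lambda>t. \<i> * complex_of_real t *
        complex_of_real (LBINT s:{0..}. (LINT x|m. cos_integrand s x) * t * exp (- s * t)))"
      \<comment> \<open>Only values at \<open>t > 0\<close> are tested, so a pointwise rewriting of
        \<open>h\<close> transfers the property; the second formula is obtained the same way from
        \<open>h'\<close>.\<close>
      by (rule voiculescu_values_cong[OF _ conjunct2[OF \<nu>]])
         (use sym symmetric_laplace_exponent in \<open>simp only: h_def\<close>)
    show "voiculescu_values_on_imag_axis \<nu> (\<lambda>t. - \<i> * complex_of_real t *
        complex_of_real (LINT x|m. (1 + x^2) / (t^2 + x^2)))"
      by (rule voiculescu_values_cong[OF _ conjunct2[OF \<nu>]])
         (use sym symmetric_nevanlinna_integral in \<open>simp add: h'\<close>)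
  qed
qed

end
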